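(* Let $H$ be a complex Hilbert space and let $T=\begin{pmatrix}A&B\\ C&-A^*\end{pmatrix}$ be a nonnegative diagonally $p$-dominant Hamiltonian in $H\times H$ with $p<1$. Suppose that $\mathrm i\mathbb R\subset\varrho(A)$ and \[\bigcap_{t\in\mathbb R}\ker\bigl(B(A^*+\mathrm i t)^{-1}\bigr)=\{0\}.\] (i) If $A$ is sectorial with angle $\theta<\pi/2$, then the nonnegative selfadjoint operator $X_+$ with $G(X_+)=V_+$ is bounded, satisfies $X_+\mathcal D(A)\subset\mathcal D(A^* )$ and hence \[(A^*X_++X_+A+X_+BX_+-C)u=0,\qquad u\in\mathcal D(A).\] Moreover, $X_+$ is the uniquely determined bounded nonnegative operator $X:H\to H$ such that $X\mathcal D(A)\subset\mathcal D(A^* )$ and $(A^*X+XA+XBX-C)u=0$ for all $u\in\mathcal D(A)$. (ii) If $-A$ is sectorial with angle $\theta<\pi/2$, then the nonpositive selfadjoint operator $X_-$ with $G(X_-)=V_-$ is bounded, satisfies $X_-\mathcal D(A)\subset\mathcal D(A^* )$ and hence \[(A^*X_-+X_-A+X_-BX_--C)u=0,\qquad u\in\mathcal D(A).\] Moreover, $X_-$ is the uniquely determined bounded nonpositive operator $X:H\to H$ such that $X\mathcal D(A)\subset\mathcal D(A^* )$ and $(A^*X+XA+XBX-C)u=0$ for all $u\in\mathcal D(A)$.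
   Context: $\mathcal D(\cdot)$ is the domain, $\varrho(\cdot)$ the resolvent set, $\sigma(\cdot)$ the spectrum; $\mathbb C_\pm$ are the open right/left half-planes. Linear operators need not be everywhere defined or bounded. Subordination: a linear operator $R$ is $p$-subordinate to $S$, $p\in[0,1]$, if $\mathcal D(S)\subset\mathcal D(R)$ and there is $c\ge0$ with $\|Rx\|\le c\|x\|^{1-p}\|Sx\|^p$ for all $x\in\mathcal D(S)$. Hamiltonian: $T=\begin{pmatrix}A&B\\ C&-A^*\end{pmatrix}$ in $H\times H$ with $A,B,C$ densely defined linear operators in $H$, $A$ closed, and $B,C$ symmetric. It is nonnegative if $B$ and $C$ are nonnegative. It is diagonally $p$-dominant if $C$ is $p$-subordinate to $A$ and $B$ is $p$-subordinate to $A^*$; then $\mathcal D(T)=\mathcal D(A)\times\mathcal D(A^* )$. Sectorial: a densely defined linear operator $S$ is sectorial with angle $\theta\in[0,\pi[$ if $\sigma(S)\subset\Sigma_\theta:=\{z:|\arg z|\le\theta\}$ (with $-\pi<\arg z\le\pi$, $\arg 0=0$) and for every $\theta'\in\,]\theta,\pi]$ there is $M>0$ with $\|(S-z)^{-1}\|\le M/|z|$ for $|\arg z|\ge\theta'$, $|z|>0$. Dichotomous: a densely defined linear operator $S$ on a Banach space $V$ is dichotomous if there exist $h>0$ and complementary closed subspaces $V=V_+\oplus V_-$ with (a) $\{z\in\mathbb C:|\operatorname{Re}z|<h\}\subset\varrho(S)$; (b) $S(\mathcal D(S)\cap V_\pm)\subset V_\pm$; (c) $\sigma(S|_{V_+})\subset\mathbb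 C_+$, $\sigma(S|_{V_-})\subset\mathbb C_-$. $V_\pm$ are the spectral subspaces, $P_\pm$ the projections onto $V_\pm$ along $V_\mp$. The operators $X_\pm$: under the hypotheses of (i) or of (ii), $A$ is sectorially dichotomous (dichotomous, with $A|_{V_+(A)}$ and $-A|_{V_-(A)}$ sectorial with some angle $<\pi/2$), and another theorem of the paper gives: $T$ is dichotomous; its spectral subspaces $V_\pm\subset H\times H$, with projections $P_\pm$ satisfying $\frac1{\pi\mathrm i}\int_{\mathrm i\mathbb R}'(T-z)^{-1}x\,dz=P_+x-P_-x$ for all $x\in H\times H$ (where $\int'_{\mathrm i\mathbb R}=\lim_{\rho\to\infty}\int_{-\mathrm i\rho}^{\mathrm i\rho}$), are graphs $V_\pm=G(X_\pm)=\{(u,X_\pm u):u\in\mathcal D(X_\pm)\}$ of selfadjoint operators $X_\pm$ on $H$, with $X_+$ nonnegative and $X_-$ nonpositive, satisfying $(A^*X_\pm+X_\pm(A+BX_\pm)-C)u=0$ for all $u\in\mathcal D(A)\cap\mathcal D(X_\pm)$ with $X_\pm u\in\mathcal D(A^* )$. *)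

theory Defs
  imports "HOL-Analysis.Analysis"
begin

section \<open>Complex Hilbert spaces\<close>

text \<open>
  A complex Hilbert space is a real Hilbert space (so that norm, topology, completeness and
  integration are the library ones) with a compatible complex scalar multiplication and a
  sesquilinear inner product, linear in the first argument, whose real part is the real inner
  product.  In particular \<open>cinner x x = (norm x)\<^sup>2\<close>.
\<close>

class complex_inner = real_inner +
  fixes scaleC :: "complex \<Rightarrow> 'a \<Rightarrow> 'a"  (infixr \<open>*\<^sub>C\<close> 75)
    and cinner :: "'a \<Rightarrow> 'a \<Rightarrow> complex"
  assumes scaleC_add_right: "c *\<^sub>C (x + y) = c *\<^sub>C x + c *\<^sub>C y"
    and scaleC_add_left: "(c + d) *\<^sub>C x = c *\<^sub>C x + d *\<^sub>C x"
    and scaleC_scaleC: "c *\<^sub>C (d *\<^sub>C x) = (c * d) *\<^sub>C x"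
    and scaleC_of_real: "complex_of_real r *\<^sub>C x = r *\<^sub>R x"
    and cinner_add_left: "cinner (x + y) z = cinner x z + cinner y z"
    and cinner_scaleC_left: "cinner (c *\<^sub>C x) y = c * cinner x y"
    and cinner_commute: "cinner x y = cnj (cinner y x)"
    and Re_cinner: "Re (cinner x y) = inner x y"

class complex_hilbert = complex_inner + complete_space

instantiation prod :: (complex_inner, complex_inner) complex_inner
begin

definition scaleC_prod_def: "c *\<^sub>C w = (c *\<^sub>C fst w, c *\<^sub>C snd w)"

definition cinner_prod_def: "cinner v w = cinner (fst v) (fst w) + cinner (snd v) (snd w)"

instance
proof
  fix x y :: "'a \<times> 'b"
  show "cinner x y = cnj (cinner y x)"
    unfolding cinner_prod_def
    by (simp add: cinner_commute[of "fst x" "fst y"] cinner_commute[of "snd x" "snd y"])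
qed (auto simp: scaleC_prod_def cinner_prod_def inner_prod_def scaleR_prod_def
      scaleC_add_right scaleC_add_left scaleC_scaleC scaleC_of_real
      cinner_add_left cinner_scaleC_left Re_cinner algebra_simps)

end

instance prod :: (complex_hilbert, complex_hilbert) complex_hilbert ..

definition csubspace :: "'a::complex_inner set \<Rightarrow> bool" where
  "csubspace V \<longleftrightarrow> subspace V \<and> (\<forall>c. \<forall>x\<in>V. c *\<^sub>C x \<in> V)"

definition bounded_clinear :: "('a::complex_inner \<Rightarrow> 'b::complex_inner) \<Rightarrow> bool" where
  "bounded_clinear f \<longleftrightarrow> bounded_linear f \<and> (\<forall>c x. f (c *\<^sub>C x) = c *\<^sub>C f x)"


section \<open>Unbounded operators\<close>

text \<open>
  An operator is a domain together with a total function whose values outside the domain are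
  irrelevant; two operators are the same mathematical object iff their graphs agree.
\<close>

datatype ('a, 'b) operator = Op (dom_op: "'a set") (app: "'a \<Rightarrow> 'b")

notation app  (infixl \<open>\<cdot>\<close> 90)

definition graph :: "('a, 'b) operator \<Rightarrow> ('a \<times> 'b) set" where
  "graph S = (\<lambda>x. (x, S \<cdot> x)) ` dom_op S"

definition linear_op :: "('a::complex_inner, 'b::complex_inner) operator \<Rightarrow> bool" where
  "linear_op S \<longleftrightarrow> csubspace (dom_op S) \<and>
     (\<forall>x\<in>dom_op S. \<forall>y\<in>dom_op S. S \<cdot> (x + y) = S \<cdot> x + S \<cdot> y) \<and>
     (\<forall>c. \<forall>x\<in>dom_op S. S \<cdot> (c *\<^sub>C x) = c *\<^sub>C (S \<cdot> x))"

definition densely_defined :: "('a::complex_inner, 'b::complex_inner) operator \<Rightarrow> bool" where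
  "densely_defined S \<longleftrightarrow> linear_op S \<and> closure (dom_op S) = UNIV"

definition closed_op :: "('a::complex_inner, 'b::complex_inner) operator \<Rightarrow> bool" where
  "closed_op S \<longleftrightarrow> closed (graph S)"

definition uminus_op :: "('a, 'b::uminus) operator \<Rightarrow> ('a, 'b) operator" where
  "uminus_op S = Op (dom_op S) (\<lambda>x. - (S \<cdot> x))"

definition adj :: "('a::complex_inner, 'b::complex_inner) operator \<Rightarrow> ('b, 'a) operator" where
  "adj S = Op {y. \<exists>w. \<forall>x\<in>dom_op S. cinner (S \<cdot> x) y = cinner x w}
              (\<lambda>y. THE w. \<forall>x\<in>dom_op S. cinner (S \<cdot> x) y = cinner x w)"

definition symmetric_op :: "('a::complex_inner, 'a) operator \<Rightarrow> bool" where
  "symmetric_op S \<longleftrightarrow> densely_defined S \<and>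
     (\<forall>x\<in>dom_op S. \<forall>y\<in>dom_op S. cinner (S \<cdot> x) y = cinner x (S \<cdot> y))"

definition selfadjoint :: "('a::complex_inner, 'a) operator \<Rightarrow> bool" where
  "selfadjoint S \<longleftrightarrow> densely_defined S \<and> graph (adj S) = graph S"

definition nonneg_op :: "('a::complex_inner, 'a) operator \<Rightarrow> bool" where
  "nonneg_op S \<longleftrightarrow> (\<forall>x\<in>dom_op S. cinner (S \<cdot> x) x \<in> \<real>\<^sub>\<ge>\<^sub>0)"

definition nonpos_op :: "('a::complex_inner, 'a) operator \<Rightarrow> bool" where
  "nonpos_op S \<longleftrightarrow> (\<forall>x\<in>dom_op S. cinner (S \<cdot> x) x \<in> \<real>\<^sub>\<le>\<^sub>0)"

text \<open>
  The convention \<open>0\<^sup>0 = 1\<close> is used for the real powers in the subordination inequality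
  (whereas \<open>0 powr 0 = 0\<close>), so that 0-subordinate means bounded on the domain of \<open>S\<close>.
\<close>

definition rpow :: "real \<Rightarrow> real \<Rightarrow> real" where
  "rpow a p = (if p = 0 then 1 else a powr p)"

definition subordinate ::
    "real \<Rightarrow> ('a::complex_inner, 'b::complex_inner) operator
      \<Rightarrow> ('a, 'c::complex_inner) operator \<Rightarrow> bool" where
  "subordinate p R S \<longleftrightarrow> 0 \<le> p \<and> p \<le> 1 \<and> dom_op S \<subseteq> dom_op R \<and>
     (\<exists>c\<ge>0. \<forall>x\<in>dom_op S.
        norm (R \<cdot> x) \<le> c * rpow (norm x) (1 - p) * rpow (norm (S \<cdot> x)) p)"


section \<open>Spectrum, sectorial and dichotomous operators\<close>

text \<open>
  Resolvent set and spectrum of an operator \<open>S\<close> acting in a subspace \<open>V\<close> of the ambient space;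
  this is needed for the parts of an operator in its spectral subspaces.
\<close>

definition resolvent_set_in :: "'a::complex_inner set \<Rightarrow> ('a, 'a) operator \<Rightarrow> complex set" where
  "resolvent_set_in V S =
     {z. bij_betw (\<lambda>x. S \<cdot> x - z *\<^sub>C x) (dom_op S) V \<and>
         (\<exists>M. \<forall>x\<in>dom_op S. norm x \<le> M * norm (S \<cdot> x - z *\<^sub>C x))}"

definition spectrum_in :: "'a::complex_inner set \<Rightarrow> ('a, 'a) operator \<Rightarrow> complex set" where
  "spectrum_in V S = - resolvent_set_in V S"

abbreviation resolvent_set :: "('a::complex_inner, 'a) operator \<Rightarrow> complex set" where
  "resolvent_set \<equiv> resolvent_set_in UNIV"

abbreviation spectrum :: "('a::complex_inner, 'a) operator \<Rightarrow> complex set" where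
  "spectrum \<equiv> spectrum_in UNIV"

text \<open>\<open>resolvent S z\<close> is \<open>(S - z)\<^sup>-\<^sup>1\<close>, meaningful for \<open>z \<in> resolvent_set S\<close>.\<close>

definition resolvent :: "('a::complex_inner, 'a) operator \<Rightarrow> complex \<Rightarrow> 'a \<Rightarrow> 'a" where
  "resolvent S z = the_inv_into (dom_op S) (\<lambda>x. S \<cdot> x - z *\<^sub>C x)"

definition sectorial :: "('a::complex_inner, 'a) operator \<Rightarrow> real \<Rightarrow> bool" where
  "sectorial S \<theta> \<longleftrightarrow> densely_defined S \<and> 0 \<le> \<theta> \<and> \<theta> < pi \<and>
     spectrum S \<subseteq> {z. \<bar>Arg z\<bar> \<le> \<theta>} \<and>
     (\<forall>\<theta>'. \<theta> < \<theta>' \<and> \<theta>' \<le> pi \<longrightarrow>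
        (\<exists>M>0. \<forall>z. z \<noteq> 0 \<and> \<theta>' \<le> \<bar>Arg z\<bar> \<longrightarrow>
           (\<forall>x. norm (resolvent S z x) \<le> M / norm z * norm x)))"

definition restrict_op :: "('a, 'b) operator \<Rightarrow> 'a set \<Rightarrow> ('a, 'b) operator" where
  "restrict_op S V = Op (dom_op S \<inter> V) (app S)"

definition complementary :: "'a::complex_inner set \<Rightarrow> 'a set \<Rightarrow> bool" where
  "complementary V W \<longleftrightarrow> csubspace V \<and> closed V \<and> csubspace W \<and> closed W \<and>
     V \<inter> W = {0} \<and> (\<forall>x. \<exists>v\<in>V. \<exists>w\<in>W. x = v + w)"

definition proj_along :: "'a::complex_inner set \<Rightarrow> 'a set \<Rightarrow> 'a \<Rightarrow> 'a" where
  "proj_along V W x = (THE v. v \<in> V \<and> x - v \<in> W)"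

text \<open>\<open>S\<close> is dichotomous with respect to the decomposition \<open>V\<^sub>+ \<oplus> V\<^sub>-\<close>.\<close>

definition dichotomous_wrt ::
    "('a::complex_inner, 'a) operator \<Rightarrow> 'a set \<Rightarrow> 'a set \<Rightarrow> bool" where
  "dichotomous_wrt S Vp Vm \<longleftrightarrow> densely_defined S \<and> complementary Vp Vm \<and>
     (\<exists>h>0. {z. \<bar>Re z\<bar> < h} \<subseteq> resolvent_set S) \<and>
     app S ` (dom_op S \<inter> Vp) \<subseteq> Vp \<and>
     app S ` (dom_op S \<inter> Vm) \<subseteq> Vm \<and>
     spectrum_in Vp (restrict_op S Vp) \<subseteq> {z. Re z > 0} \<and>
     spectrum_in Vm (restrict_op S Vm) \<subseteq> {z. Re z < 0}"

text \<open>
  The defining conditions of a dichotomous operator need not determine the decomposition (a part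
  with empty spectrum could be put on either side).  The spectral subspaces meant here are those
  whose projections satisfy
  \<open>1/(\<pi>i) \<integral>'\<^sub>i\<^sub>\<real> (S - z)\<^sup>-\<^sup>1 x dz = P\<^sub>+ x - P\<^sub>- x\<close>, which does determine them;
  below, the integral is parametrised by \<open>z = i t\<close>, \<open>dz = i dt\<close>.
\<close>

definition spectral_subspaces ::
    "('a::complex_hilbert, 'a) operator \<Rightarrow> 'a set \<Rightarrow> 'a set \<Rightarrow> bool" where
  "spectral_subspaces S Vp Vm \<longleftrightarrow> dichotomous_wrt S Vp Vm \<and>
     (\<forall>x. ((\<lambda>\<rho>. (1 / (of_real pi * \<i>)) *\<^sub>C
              integral {- \<rho>..\<rho>} (\<lambda>t. \<i> *\<^sub>C resolvent S (\<i> * of_real t) x))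
           \<longlongrightarrow> proj_along Vp Vm x - proj_along Vm Vp x) at_top)"


section \<open>Hamiltonians\<close>

definition ham ::
    "('a::complex_inner, 'a) operator \<Rightarrow> ('a, 'a) operator \<Rightarrow> ('a, 'a) operator
      \<Rightarrow> ('a \<times> 'a, 'a \<times> 'a) operator" where
  "ham A B C = Op ((dom_op A \<inter> dom_op C) \<times> (dom_op B \<inter> dom_op (adj A)))
                  (\<lambda>(x, y). (A \<cdot> x + B \<cdot> y, C \<cdot> x - adj A \<cdot> y))"

definition hamiltonian ::
    "('a::complex_inner, 'a) operator \<Rightarrow> ('a, 'a) operator \<Rightarrow> ('a, 'a) operator \<Rightarrow> bool" where
  "hamiltonian A B C \<longleftrightarrow> densely_defined A \<and> closed_op A \<and> symmetric_op B \<and> symmetric_op C"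

definition diagonally_dominant ::
    "real \<Rightarrow> ('a::complex_inner, 'a) operator \<Rightarrow> ('a, 'a) operator \<Rightarrow> ('a, 'a) operator \<Rightarrow> bool" where
  "diagonally_dominant p A B C \<longleftrightarrow> subordinate p C A \<and> subordinate p B (adj A)"

definition riccati_solution ::
    "('a::complex_inner, 'a) operator \<Rightarrow> ('a, 'a) operator \<Rightarrow> ('a, 'a) operator
      \<Rightarrow> ('a \<Rightarrow> 'a) \<Rightarrow> bool" where
  "riccati_solution A B C X \<longleftrightarrow> X ` dom_op A \<subseteq> dom_op (adj A) \<and>
     (\<forall>u\<in>dom_op A. adj A \<cdot> X u + X (A \<cdot> u) + X (B \<cdot> X u) - C \<cdot> u = 0)"

end

theory Submission
  imports Defs "HOL-Complex_Analysis.Cauchy_Integral_Theorem"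
begin

text \<open>
  Write \<open>T\<close> for the Hamiltonian and \<open>w\<^sub>t = (u\<^sub>t, v\<^sub>t) = (T - i t)\<^sup>-\<^sup>1 w\<close> for \<open>w = (u, X u)\<close> in \<open>V\<^sub>+\<close>.  Taking the real part of
  the pairing of \<open>(T - i t) w\<^sub>t = w\<close> with \<open>(v\<^sub>t, u\<^sub>t)\<close> gives
  \<open>\<langle>C u\<^sub>t, u\<^sub>t\<rangle> + \<langle>B v\<^sub>t, v\<^sub>t\<rangle> = Re (\<langle>X u, u\<^sub>t\<rangle> + \<langle>u, v\<^sub>t\<rangle>)\<close>, and the principal value integral that defines
  \<open>V\<^sub>+\<close> turns the right-hand side into \<open>2 \<pi> \<langle>X u, u\<rangle>\<close>.  So \<open>\<langle>X u, u\<rangle>\<close> is the optimal cost of a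
  linear-quadratic control problem, seen in the frequency domain, and everything about \<open>X\<close> can be
  read off from resolvents on the imaginary axis; no semigroup is involved.

  Boundedness.  The optimal cost is at most the cost of the trajectory without control.  In the frequency
  domain this trajectory is \<open>r\<^sub>t = (A - i t)\<^sup>-\<^sup>1 u\<close>, and the comparison (\<open>cost_comparison\<close>) is an identity
  plus nonnegative terms, up to the summand \<open>2 Re \<langle>X u, r\<^sub>t - u\<^sub>t\<rangle>\<close>.  That summand integrates to zero because
  the principal value integrals of \<open>r\<^sub>t\<close> and \<open>u\<^sub>t\<close> are both \<open>\<pi> u\<close>: for \<open>u\<^sub>t\<close> since \<open>w\<close> is in \<open>V\<^sub>+\<close>, for \<open>r\<^sub>t\<close> by
  Cauchy's theorem in the left half-plane (\<open>resolvent_integral_limit\<close>).  Since \<open>C\<close> is subordinate to \<open>A\<close>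
  with exponent \<open>p < 1\<close>, \<open>\<langle>C r\<^sub>t, r\<^sub>t\<rangle>\<close> is at most a constant times \<open>(1 + \<bar>t\<bar>) powr (p - 2)\<close>, which is integrable.
  Hence the quadratic form of \<open>X\<close> is bounded, and so is \<open>X\<close> (\<open>bounded_form_imp_bounded\<close>).

  The Riccati equation.  Invariance of the graph gives it on the vectors \<open>u\<close> in the domain of \<open>A\<close> for which
  \<open>X u\<close> is in the domain of \<open>A\<^sup>*\<close>.  There \<open>B X\<close> is a small perturbation of \<open>A + \<mu>\<close> for large \<open>\<mu>\<close>, and a Neumann
  argument shows that these vectors exhaust the domain of \<open>A\<close> (\<open>invariant_graph_riccati\<close>).

  Uniqueness.  For any bounded nonnegative solution \<open>X\<close> the graph of \<open>X\<close> is invariant and the part of \<open>T\<close> in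
  it is the closed-loop operator \<open>A + B X\<close>.  Its resolvent exists on the whole closed left half-plane and decays
  there like that of \<open>A\<close> (\<open>closed_loop_resolvent_decay\<close>), so the principal value integral acts as \<open>\<pi>\<close> times the
  identity on the graph, which must therefore lie in \<open>V\<^sub>+\<close>.

  The case that \<open>- A\<close> is sectorial follows by the symmetry \<open>(x, y) \<mapsto> (x, - y)\<close>, which transforms \<open>- T\<close> into the
  Hamiltonian of \<open>- A\<close>, \<open>B\<close>, \<open>C\<close> and thereby exchanges the two spectral subspaces.
\<close>

section \<open>Complex inner product spaces\<close>

instance complex_hilbert \<subseteq> banach ..

lemma cinner_add_right: "cinner x (y + z) = cinner x y + cinner x z"
  for x y z :: "'a::complex_inner"
  by (metis cinner_add_left cinner_commute complex_cnj_add)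

lemma cinner_scaleC_right: "cinner x (c *\<^sub>C y) = cnj c * cinner x y"
  for x y :: "'a::complex_inner"
  by (metis cinner_scaleC_left cinner_commute complex_cnj_mult)

lemma scaleC_one [simp]: "1 *\<^sub>C x = x" for x :: "'a::complex_inner"
  using scaleC_of_real[of 1 x] by simp

lemma scaleC_zero_left [simp]: "0 *\<^sub>C x = 0" for x :: "'a::complex_inner"
  using scaleC_of_real[of 0 x] by simp

lemma scaleC_zero_right [simp]: "c *\<^sub>C (0::'a::complex_inner) = 0"
  using scaleC_add_right[of c "0::'a" 0] by simp

lemma scaleC_minus_one: "(- 1) *\<^sub>C x = - x" for x :: "'a::complex_inner"
  using scaleC_of_real[of "-1" x] by simp

lemma scaleC_minus_left [simp]: "(- c) *\<^sub>C x = - (c *\<^sub>C x)" for x :: "'a::complex_inner"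
  by (metis mult_minus1 scaleC_minus_one scaleC_scaleC)

lemma scaleC_minus_right [simp]: "c *\<^sub>C (- x) = - (c *\<^sub>C x)" for x :: "'a::complex_inner"
  by (metis mult.commute scaleC_minus_one scaleC_scaleC)

lemma scaleC_diff_right: "c *\<^sub>C (x - y) = c *\<^sub>C x - c *\<^sub>C y" for x y :: "'a::complex_inner"
  using scaleC_add_right[of c x "- y"] by simp

lemma scaleC_diff_left: "(c - d) *\<^sub>C x = c *\<^sub>C x - d *\<^sub>C x" for x :: "'a::complex_inner"
  using scaleC_add_left[of c "- d" x] by simp

lemma cinner_minus_left [simp]: "cinner (- x) y = - cinner x y" for x y :: "'a::complex_inner"
  using cinner_scaleC_left[of "-1" x y] by (simp add: scaleC_minus_one)

lemma cinner_minus_right [simp]: "cinner x (- y) = - cinner x y" for x y :: "'a::complex_inner"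
  using cinner_scaleC_right[of x "-1" y] by (simp add: scaleC_minus_one)

lemma cinner_diff_left: "cinner (x - y) z = cinner x z - cinner y z"
  for x y z :: "'a::complex_inner"
  using cinner_add_left[of x "- y" z] by simp

lemma cinner_diff_right: "cinner x (y - z) = cinner x y - cinner x z"
  for x y z :: "'a::complex_inner"
  using cinner_add_right[of x y "- z"] by simp

lemma cinner_zero_left [simp]: "cinner 0 y = 0" for y :: "'a::complex_inner"
  using cinner_scaleC_left[of 0 0 y] by simp

lemma cinner_zero_right [simp]: "cinner x 0 = 0" for x :: "'a::complex_inner"
  using cinner_scaleC_right[of x 0 0] by simp

lemmas cinner_algebra = cinner_add_left cinner_add_right cinner_diff_left cinner_diff_right
  cinner_scaleC_left cinner_scaleC_right

lemma Re_cinner_commute: "Re (cinner x y) = Re (cinner y x)" for x y :: "'a::complex_inner"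
  by (simp add: Re_cinner inner_commute)

lemma Re_cinner_self: "Re (cinner x x) = (norm x)\<^sup>2" for x :: "'a::complex_inner"
  by (simp add: Re_cinner power2_norm_eq_inner)

lemma cinner_self: "cinner x x = of_real ((norm x)\<^sup>2)" for x :: "'a::complex_inner"
  by (metis Reals_cnj_iff Re_cinner_self cinner_commute complex_is_Real_iff of_real_Re)

lemma norm_scaleC: "norm (c *\<^sub>C x) = cmod c * norm x" for x :: "'a::complex_inner"
proof -
  have "complex_of_real ((norm (c *\<^sub>C x))\<^sup>2) = (c * cnj c) * cinner x x"
    unfolding cinner_self[symmetric] by (simp add: cinner_algebra)
  also have "\<dots> = of_real ((cmod c * norm x)\<^sup>2)"
    by (simp add: cinner_self complex_norm_square[symmetric] power_mult_distrib)
  finally have "complex_of_real ((norm (c *\<^sub>C x))\<^sup>2) = of_real ((cmod c * norm x)\<^sup>2)" .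
  hence "(norm (c *\<^sub>C x))\<^sup>2 = (cmod c * norm x)\<^sup>2" using of_real_eq_iff by blast
  thus ?thesis by (simp add: power2_eq_iff_nonneg)
qed

lemma norm_add_scaleC_le: "norm (x + c *\<^sub>C y) \<le> norm x + cmod c * norm y"
  for x y :: "'a::complex_inner"
  using norm_triangle_ineq[of x "c *\<^sub>C y"] by (simp add: norm_scaleC)

lemma Re_cinner_le: "Re (cinner x y) \<le> norm x * norm y" for x y :: "'a::complex_inner"
  by (simp add: Re_cinner norm_cauchy_schwarz)

text \<open>The modulus of a complex number is the real part of a rotated copy of it, which reduces
  the complex Cauchy-Schwarz inequality to the real one.\<close>

lemma norm_cinner_le: "cmod (cinner x y) \<le> norm x * norm y" for x y :: "'a::complex_inner"
proof (cases "cinner x y = 0")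
  case False
  define c where "c = cnj (sgn (cinner x y))"
  have "c * cinner x y = of_real (cmod (cinner x y))"
    using False by (simp add: c_def sgn_eq complex_norm_square[symmetric] power2_eq_square mult.commute)
  hence "cmod (cinner x y) = Re (cinner (c *\<^sub>C x) y)"
    by (simp add: cinner_scaleC_left)
  also have "\<dots> \<le> norm (c *\<^sub>C x) * norm y" by (rule Re_cinner_le)
  also have "\<dots> = norm x * norm y" using False by (simp add: norm_scaleC c_def norm_sgn)
  finally show ?thesis .
qed simp

lemma bounded_linear_cinner_left: "bounded_linear (\<lambda>x. cinner x y)" for y :: "'a::complex_inner"
proof (rule bounded_linear_intro[where K = "norm y"])
  show "cinner (r *\<^sub>R x) y = r *\<^sub>R cinner x y" for r and x :: 'a
    by (simp flip: scaleC_of_real add: cinner_algebra scaleR_conv_of_real)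
qed (auto simp: cinner_algebra norm_cinner_le)

lemma bounded_linear_scaleC_right: "bounded_linear (\<lambda>x::'a::complex_inner. c *\<^sub>C x)"
proof (rule bounded_linear_intro[where K = "cmod c"])
  show "c *\<^sub>C (r *\<^sub>R x) = r *\<^sub>R (c *\<^sub>C x)" for r and x :: 'a
    by (simp flip: scaleC_of_real add: scaleC_scaleC mult.commute)
qed (auto simp: scaleC_add_right norm_scaleC)

lemma cinner_ext:
  fixes x y :: "'a::complex_inner"
  assumes "\<And>v. cinner x v = cinner y v"
  shows "x = y"
proof -
  have "cinner (x - y) (x - y) = 0" using assms by (simp add: cinner_diff_left)
  thus ?thesis by (simp add: cinner_self)
qed

lemma dense_cinner_ext:
  fixes a b :: "'a::complex_inner"
  assumes "closure D = UNIV" and eq: "\<And>x. x \<in> D \<Longrightarrow> cinner x a = cinner x b"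
  shows "a = b"
proof -
  have "closed {x::'a. cinner x (a - b) = 0}"
    by (intro closed_Collect_eq continuous_on_const
        bounded_linear.continuous_on[OF bounded_linear_cinner_left] continuous_on_id)
  moreover have "D \<subseteq> {x. cinner x (a - b) = 0}" using eq by (auto simp: cinner_algebra)
  ultimately have "closure D \<subseteq> {x. cinner x (a - b) = 0}" by (metis closure_minimal)
  hence "cinner (a - b) (a - b) = 0" using assms(1) by auto
  thus ?thesis by (simp add: cinner_self)
qed

lemma csubspace_ops:
  assumes "csubspace V"
  shows "0 \<in> V" "x \<in> V \<Longrightarrow> y \<in> V \<Longrightarrow> x + y \<in> V" "x \<in> V \<Longrightarrow> y \<in> V \<Longrightarrow> x - y \<in> V"
    "x \<in> V \<Longrightarrow> c *\<^sub>C x \<in> V" "x \<in> V \<Longrightarrow> - x \<in> V"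
  using assms by (auto simp: csubspace_def subspace_0 subspace_add subspace_diff subspace_neg)

lemma csubspaceI:
  assumes "0 \<in> V" "\<And>x y. x \<in> V \<Longrightarrow> y \<in> V \<Longrightarrow> x + y \<in> V" "\<And>c x. x \<in> V \<Longrightarrow> c *\<^sub>C x \<in> V"
  shows "csubspace V"
  unfolding csubspace_def subspace_def using assms by (metis scaleC_of_real)

text \<open>The representing vector minimises \<open>(norm x)\<^sup>2 - 2 f x\<close>; by the parallelogram law a
  minimising sequence is Cauchy.\<close>

lemma riesz_real:
  fixes f :: "'a::{real_inner, complete_space} \<Rightarrow> real"
  assumes "bounded_linear f"
  obtains x where "\<And>h. f h = inner h x"
proof -
  interpret f: bounded_linear f by fact
  obtain K where K: "\<And>x. norm (f x) \<le> norm x * K" using f.bounded by blast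
  define \<phi> where "\<phi> x = (norm x)\<^sup>2 - 2 * f x" for x
  have lower: "- (K\<^sup>2) \<le> \<phi> x" for x
  proof -
    have "f x \<le> norm x * K" using K[of x] by simp
    moreover have "0 \<le> (norm x - K)\<^sup>2" by simp
    ultimately show ?thesis by (simp add: \<phi>_def power2_diff)
  qed
  define m where "m = (INF x. \<phi> x)"
  have bdd: "bdd_below (range \<phi>)" using lower by (auto intro!: bdd_belowI)
  have m_le: "m \<le> \<phi> x" for x unfolding m_def by (rule cINF_lower[OF bdd]) simp
  have "\<exists>x. \<phi> x < m + 1 / Suc n" for n
    using cINF_less_iff[OF _ bdd, of "m + 1 / Suc n"] by (auto simp: m_def)
  then obtain X where X: "\<And>n. \<phi> (X n) < m + 1 / Suc n" by metis
  have par: "(norm (x - y))\<^sup>2 = 2 * \<phi> x + 2 * \<phi> y - 4 * \<phi> ((1/2) *\<^sub>R (x + y))" for x y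
    by (simp add: \<phi>_def power2_norm_eq_inner f.add f.scaleR inner_add_left inner_add_right
        inner_diff_left inner_diff_right inner_commute power_divide)
       (simp add: field_simps)
  have "Cauchy X"
  proof (rule CauchyI)
    fix e :: real assume "e > 0"
    then obtain N where N: "1 / Suc N < e\<^sup>2 / 4"
      by (metis divide_pos_pos nat_approx_posE zero_less_numeral zero_less_power)
    have "norm (X i - X j) < e" if "i \<ge> N" "j \<ge> N" for i j
    proof -
      have "1 / real (Suc i) \<le> 1 / Suc N" "1 / real (Suc j) \<le> 1 / Suc N"
        using that by (auto simp: frac_le)
      hence "(norm (X i - X j))\<^sup>2 < e\<^sup>2"
        using par[of "X i" "X j"] X[of i] X[of j] m_le[of "(1/2) *\<^sub>R (X i + X j)"] N by linarith
      thus ?thesis using \<open>e > 0\<close> by (simp add: power2_less_imp_less)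
    qed
    thus "\<exists>N. \<forall>i\<ge>N. \<forall>j\<ge>N. norm (X i - X j) < e" by blast
  qed
  then obtain x where x: "X \<longlonglongrightarrow> x" using Cauchy_convergent convergent_def by blast
  have "(\<lambda>n. \<phi> (X n)) \<longlonglongrightarrow> \<phi> x" unfolding \<phi>_def
    by (intro tendsto_intros x f.tendsto)
  moreover have "(\<lambda>n. m + 1 / real (Suc n)) \<longlonglongrightarrow> m + 0"
    by (intro tendsto_intros LIMSEQ_Suc[OF lim_1_over_n])
  ultimately have "\<phi> x \<le> m + 0"
    by (rule LIMSEQ_le) (use X in \<open>auto intro: less_imp_le\<close>)
  hence min: "\<phi> x \<le> \<phi> y" for y using m_le[of y] by simp
  have "f h = inner h x" for h
  proof -
    define d where "d = inner h x - f h"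
    have q: "0 \<le> 2 * r * d + r\<^sup>2 * (norm h)\<^sup>2" for r
      using min[of "x + r *\<^sub>R h"]
      by (simp add: \<phi>_def d_def power2_norm_eq_inner f.add f.scaleR inner_add_left inner_add_right
          inner_commute) (simp add: power2_eq_square algebra_simps power2_norm_eq_inner)
    have "d = 0"
    proof (rule ccontr)
      assume "d \<noteq> 0"
      define n where "n = (norm h)\<^sup>2 + 1"
      have n: "n > 0" unfolding n_def by (simp add: add_nonneg_pos)
      have "0 \<le> 2 * (- d / n) * d + (- d / n)\<^sup>2 * (norm h)\<^sup>2" by (rule q)
      also have "\<dots> \<le> 2 * (- d / n) * d + (- d / n)\<^sup>2 * n"
        by (intro add_left_mono mult_left_mono) (auto simp: n_def)
      also have "\<dots> = - (d\<^sup>2 / n)" using n by (simp add: field_simps power2_eq_square)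
      finally show False using \<open>d \<noteq> 0\<close> n by (simp add: divide_le_0_iff)
    qed
    thus ?thesis by (simp add: d_def)
  qed
  thus ?thesis by (rule that)
qed

lemma riesz_complex:
  fixes f :: "'a::complex_hilbert \<Rightarrow> complex"
  assumes "bounded_linear f" and cf: "\<And>c x. f (c *\<^sub>C x) = c * f x"
  obtains x where "\<And>h. f h = cinner h x"
proof -
  obtain x where x: "\<And>h. Re (f h) = inner h x"
    using riesz_real[of "\<lambda>h. Re (f h)"] bounded_linear_compose[OF bounded_linear_Re assms(1)]
    by blast
  have "f h = cinner h x" for h
  proof (rule complex_eqI)
    show "Re (f h) = Re (cinner h x)" by (simp add: x Re_cinner)
    show "Im (f h) = Im (cinner h x)"
      using x[of "(- \<i>) *\<^sub>C h"] unfolding Re_cinner[symmetric] cf cinner_scaleC_left by simp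
  qed
  thus ?thesis by (rule that)
qed

section \<open>Operators, adjoints and resolvents\<close>

lemma linear_op_rules:
  assumes "linear_op S"
  shows "csubspace (dom_op S)"
    and "x \<in> dom_op S \<Longrightarrow> y \<in> dom_op S \<Longrightarrow> S \<cdot> (x + y) = S \<cdot> x + S \<cdot> y"
    and "x \<in> dom_op S \<Longrightarrow> S \<cdot> (c *\<^sub>C x) = c *\<^sub>C (S \<cdot> x)"
    and "x \<in> dom_op S \<Longrightarrow> S \<cdot> (- x) = - (S \<cdot> x)"
    and "x \<in> dom_op S \<Longrightarrow> y \<in> dom_op S \<Longrightarrow> S \<cdot> (x - y) = S \<cdot> x - S \<cdot> y"
    and "S \<cdot> 0 = 0"
proof -
  show sub: "csubspace (dom_op S)" using assms by (simp add: linear_op_def)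
  show add: "x \<in> dom_op S \<Longrightarrow> y \<in> dom_op S \<Longrightarrow> S \<cdot> (x + y) = S \<cdot> x + S \<cdot> y" for x y
    using assms by (simp add: linear_op_def)
  show scale: "x \<in> dom_op S \<Longrightarrow> S \<cdot> (c *\<^sub>C x) = c *\<^sub>C (S \<cdot> x)" for c x
    using assms by (simp add: linear_op_def)
  show neg: "x \<in> dom_op S \<Longrightarrow> S \<cdot> (- x) = - (S \<cdot> x)" for x
    using scale[of x "-1"] by (simp add: scaleC_minus_one)
  show "x \<in> dom_op S \<Longrightarrow> y \<in> dom_op S \<Longrightarrow> S \<cdot> (x - y) = S \<cdot> x - S \<cdot> y"
    using add[of x "- y"] neg[of y] csubspace_ops(5)[OF sub] by simp
  show "S \<cdot> 0 = 0" using scale[of 0 0] csubspace_ops(1)[OF sub] by simp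
qed

lemma bounded_clinear_rules:
  assumes "bounded_clinear f"
  shows "f (x + y) = f x + f y" "f (x - y) = f x - f y" "f (c *\<^sub>C x) = c *\<^sub>C f x" "f 0 = 0"
    "f (- x) = - f x"
proof -
  have "linear f" using assms by (simp add: bounded_clinear_def bounded_linear.linear)
  thus "f (x + y) = f x + f y" "f (x - y) = f x - f y" "f 0 = 0" "f (- x) = - f x"
    by (rule linear_add linear_diff linear_0 linear_neg)+
  show "f (c *\<^sub>C x) = c *\<^sub>C f x" using assms by (simp add: bounded_clinear_def)
qed

lemma bounded_clinear_bound:
  assumes "bounded_clinear f"
  obtains N where "N > 0" "\<And>x. norm (f x) \<le> N * norm x"
  using assms bounded_linear.pos_bounded[of f] by (auto simp: bounded_clinear_def mult.commute)

lemma adjI: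
  assumes "densely_defined S" and "\<And>x. x \<in> dom_op S \<Longrightarrow> cinner (S \<cdot> x) y = cinner x w"
  shows "y \<in> dom_op (adj S)" "adj S \<cdot> y = w"
proof -
  show "y \<in> dom_op (adj S)" using assms by (auto simp: adj_def)
  have "(THE w. \<forall>x\<in>dom_op S. cinner (S \<cdot> x) y = cinner x w) = w"
  proof (rule the_equality)
    fix w' assume "\<forall>x\<in>dom_op S. cinner (S \<cdot> x) y = cinner x w'"
    thus "w' = w" using assms by (intro dense_cinner_ext[of "dom_op S"]) (auto simp: densely_defined_def)
  qed (use assms in auto)
  thus "adj S \<cdot> y = w" by (simp add: adj_def)
qed

lemma adjD:
  assumes "densely_defined S" "y \<in> dom_op (adj S)" "x \<in> dom_op S"
  shows "cinner (S \<cdot> x) y = cinner x (adj S \<cdot> y)"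
proof -
  obtain w where w: "\<And>x. x \<in> dom_op S \<Longrightarrow> cinner (S \<cdot> x) y = cinner x w"
    using assms(2) by (auto simp: adj_def)
  show ?thesis using adjI(2)[OF assms(1) w] w assms(3) by simp
qed

lemma linear_op_adj:
  assumes "densely_defined S"
  shows "linear_op (adj S)"
proof -
  have add: "x + y \<in> dom_op (adj S) \<and> adj S \<cdot> (x + y) = adj S \<cdot> x + adj S \<cdot> y"
    if "x \<in> dom_op (adj S)" "y \<in> dom_op (adj S)" for x y
    using adjI[OF assms, of "x + y" "adj S \<cdot> x + adj S \<cdot> y"] adjD[OF assms] that
    by (auto simp: cinner_algebra)
  have scale: "c *\<^sub>C x \<in> dom_op (adj S) \<and> adj S \<cdot> (c *\<^sub>C x) = c *\<^sub>C (adj S \<cdot> x)"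
    if "x \<in> dom_op (adj S)" for c x
    using adjI[OF assms, of "c *\<^sub>C x" "c *\<^sub>C (adj S \<cdot> x)"] adjD[OF assms] that
    by (auto simp: cinner_algebra)
  have "0 \<in> dom_op (adj S)" using adjI(1)[OF assms, of 0 0] by auto
  thus ?thesis unfolding linear_op_def using add scale by (auto intro!: csubspaceI)
qed

lemma symmetric_op_cinner:
  assumes "symmetric_op S" "x \<in> dom_op S" "y \<in> dom_op S"
  shows "cinner (S \<cdot> x) y = cinner x (S \<cdot> y)"
  using assms by (auto simp: symmetric_op_def)

lemma symmetric_op_linear: "symmetric_op S \<Longrightarrow> linear_op S"
  by (simp add: symmetric_op_def densely_defined_def)

lemma selfadjoint_imp_symmetric:
  assumes "selfadjoint S"
  shows "symmetric_op S"
proof -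
  have dd: "densely_defined S" and g: "graph (adj S) = graph S"
    using assms by (auto simp: selfadjoint_def)
  have "y \<in> dom_op (adj S) \<and> adj S \<cdot> y = S \<cdot> y" if "y \<in> dom_op S" for y
  proof -
    have "(y, S \<cdot> y) \<in> graph (adj S)" using that unfolding g by (auto simp: graph_def)
    thus ?thesis by (auto simp: graph_def)
  qed
  thus ?thesis using dd adjD[OF dd] by (auto simp: symmetric_op_def)
qed

lemma nonneg_op_Re:
  assumes "nonneg_op S" "x \<in> dom_op S"
  shows "0 \<le> Re (cinner (S \<cdot> x) x)"
  using assms by (auto simp: nonneg_op_def complex_nonneg_Reals_iff)

text \<open>Cauchy-Schwarz for the semi-inner product \<open>Re \<langle>S x, y\<rangle>\<close>: the quadratic polynomial
  \<open>r \<mapsto> Re \<langle>S (x + r y), x + r y\<rangle>\<close> has no sign change.\<close>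

lemma nonneg_op_cauchy_schwarz:
  assumes S: "symmetric_op S" "nonneg_op S" and x: "x \<in> dom_op S" and y: "y \<in> dom_op S"
  shows "(Re (cinner (S \<cdot> x) y))\<^sup>2 \<le> Re (cinner (S \<cdot> x) x) * Re (cinner (S \<cdot> y) y)"
proof -
  note lin = linear_op_rules[OF symmetric_op_linear[OF S(1)]]
  define a b d where "a = Re (cinner (S \<cdot> x) x)" and "b = Re (cinner (S \<cdot> x) y)"
    and "d = Re (cinner (S \<cdot> y) y)"
  have a: "0 \<le> a" and d: "0 \<le> d" using nonneg_op_Re[OF S(2)] x y by (auto simp: a_def d_def)
  have b': "Re (cinner (S \<cdot> y) x) = b"
    using symmetric_op_cinner[OF S(1) y x] Re_cinner_commute[of "S \<cdot> x" y] by (simp add: b_def)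
  have quad: "0 \<le> a + 2 * r * b + r\<^sup>2 * d" for r
  proof -
    define ry where "ry = complex_of_real r *\<^sub>C y"
    have ry: "ry \<in> dom_op S" unfolding ry_def using y lin(1) csubspace_ops(4) by blast
    have Sry: "S \<cdot> ry = complex_of_real r *\<^sub>C (S \<cdot> y)" unfolding ry_def using y lin(3) by blast
    have "Re (cinner (S \<cdot> (x + ry)) (x + ry)) = a + 2 * r * b + r\<^sup>2 * d"
      unfolding lin(2)[OF x ry] Sry
      by (simp add: ry_def cinner_algebra b' flip: a_def b_def d_def)
         (simp add: power2_eq_square algebra_simps)
    moreover have "x + ry \<in> dom_op S" using x ry lin(1) csubspace_ops(2) by blast
    ultimately show ?thesis using nonneg_op_Re[OF S(2), of "x + ry"] by simp
  qed
  show ?thesis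
  proof (cases "d = 0")
    case True
    have "b = 0"
    proof (rule ccontr)
      assume "b \<noteq> 0"
      thus False using quad[of "- (a + 1) / (2 * b)"] True a by (simp add: field_simps)
    qed
    thus ?thesis using a d by (simp flip: a_def b_def d_def)
  next
    case False
    hence "d > 0" using d by simp
    have "0 \<le> d * (a + 2 * (- b / d) * b + (- b / d)\<^sup>2 * d)"
      using quad[of "- b / d"] \<open>d > 0\<close> by (intro mult_nonneg_nonneg) auto
    also have "\<dots> = a * d - b\<^sup>2" using \<open>d > 0\<close> by (simp add: field_simps power2_eq_square)
    finally show ?thesis by (simp flip: a_def b_def d_def)
  qed
qed

text \<open>The additive form of subordination is linear in both norms; letting \<open>s\<close> grow makes
  the factor \<open>s powr (p - 1)\<close> small, which is how \<open>p < 1\<close> is exploited.  It follows from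
  \<open>a powr (1 - p) * b powr p \<le> max a b\<close>, applied to \<open>s\<close> times the first norm and to the second norm.\<close>

lemma subordinate_additive:
  assumes "subordinate p R S" "p < 1"
  obtains c where "c \<ge> 0" "dom_op S \<subseteq> dom_op R"
    "\<And>s x. s > 0 \<Longrightarrow> x \<in> dom_op S \<Longrightarrow>
       norm (R \<cdot> x) \<le> c * s powr (p - 1) * (s * norm x + norm (S \<cdot> x))"
proof -
  obtain c where p0: "0 \<le> p" and dom: "dom_op S \<subseteq> dom_op R" and c: "c \<ge> 0"
    "\<And>x. x \<in> dom_op S \<Longrightarrow> norm (R \<cdot> x) \<le> c * rpow (norm x) (1 - p) * rpow (norm (S \<cdot> x)) p"
    using assms(1) by (auto simp: subordinate_def)
  have key: "rpow a (1 - p) * rpow b p \<le> s powr (p - 1) * (s * a + b)"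
    if "a \<ge> 0" "b \<ge> 0" "s > 0" for a b s :: real
  proof (cases "s * a + b = 0")
    case True
    hence "a = 0" using that by (simp add: add_nonneg_eq_0_iff)
    thus ?thesis using True assms(2) by (simp add: rpow_def)
  next
    case False
    define m where "m = s * a + b"
    have m: "m > 0" using False that by (simp add: m_def less_le)
    have "rpow a (1 - p) = s powr (p - 1) * (s * a) powr (1 - p)"
      using that assms(2) by (simp add: rpow_def powr_mult flip: powr_add mult.assoc)
    also have "\<dots> \<le> s powr (p - 1) * m powr (1 - p)"
      using that assms(2) by (intro mult_left_mono powr_mono2) (auto simp: m_def)
    finally have 1: "rpow a (1 - p) \<le> s powr (p - 1) * m powr (1 - p)" .
    have "rpow b p \<le> m powr p"
      using that p0 m by (auto simp: rpow_def m_def intro!: powr_mono2)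
    hence "rpow a (1 - p) * rpow b p \<le> s powr (p - 1) * m powr (1 - p) * m powr p"
      by (intro mult_mono 1) (auto simp: rpow_def)
    also have "\<dots> = s powr (p - 1) * m" using m by (simp add: mult.assoc flip: powr_add)
    finally show ?thesis by (simp add: m_def)
  qed
  have "norm (R \<cdot> x) \<le> c * s powr (p - 1) * (s * norm x + norm (S \<cdot> x))"
    if "s > 0" "x \<in> dom_op S" for s x
  proof -
    have "norm (R \<cdot> x) \<le> c * (rpow (norm x) (1 - p) * rpow (norm (S \<cdot> x)) p)"
      using c(2)[OF that(2)] by (simp add: mult.assoc)
    also have "\<dots> \<le> c * (s powr (p - 1) * (s * norm x + norm (S \<cdot> x)))"
      using c(1) that by (intro mult_left_mono key) auto
    finally show ?thesis by (simp add: mult.assoc)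
  qed
  thus ?thesis using that c(1) dom by blast
qed

lemma powr_small:
  fixes p \<epsilon> :: real
  assumes "p < 1" "\<epsilon> > 0"
  obtains s where "s > 1" "c * s powr (p - 1) \<le> \<epsilon>"
proof -
  have "((\<lambda>s. c * s powr (p - 1)) \<longlongrightarrow> c * 0) at_top"
    using assms by (intro tendsto_intros tendsto_neg_powr filterlim_ident) auto
  hence "eventually (\<lambda>s. c * s powr (p - 1) < \<epsilon>) at_top"
    using assms(2) by (intro order_tendstoD) auto
  hence "eventually (\<lambda>s. c * s powr (p - 1) < \<epsilon> \<and> s > 1) at_top"
    using eventually_gt_at_top[of 1] by eventually_elim auto
  then obtain s where "c * s powr (p - 1) < \<epsilon> \<and> s > 1"
    using eventually_happens'[OF trivial_limit_at_top_linorder] by blast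
  thus ?thesis using that[of s] by simp
qed

text \<open>Neumann's perturbation argument for unbounded operators: to solve \<open>S u + R u = g\<close>, look for
  \<open>f = S u\<close> as a fixed point of \<open>f \<mapsto> g - R u\<close>, where \<open>u\<close> is any solution of \<open>S u = f\<close>; by
  smallness of \<open>R\<close> with respect to \<open>S\<close> this is a contraction.\<close>

lemma onto_perturbation:
  fixes S R :: "'a::real_normed_vector \<Rightarrow> 'b::banach"
  assumes diff: "\<And>u v. u \<in> D \<Longrightarrow> v \<in> D \<Longrightarrow> u - v \<in> D"
    and S: "\<And>u v. u \<in> D \<Longrightarrow> v \<in> D \<Longrightarrow> S (u - v) = S u - S v"
    and R: "\<And>u v. u \<in> D \<Longrightarrow> v \<in> D \<Longrightarrow> R (u - v) = R u - R v"
    and small: "\<And>u. u \<in> D \<Longrightarrow> norm (R u) \<le> q * norm (S u)" and q: "0 \<le> q" "q < 1"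
    and onto: "\<And>f. \<exists>u\<in>D. S u = f"
  shows "\<exists>u\<in>D. S u + R u = g"
proof -
  obtain \<sigma> where \<sigma>: "\<And>f. \<sigma> f \<in> D" "\<And>f. S (\<sigma> f) = f" using onto by metis
  have "\<exists>!f. g - R (\<sigma> f) = f"
  proof (rule banach_fix_type[OF q], intro allI)
    fix x y
    have "dist (g - R (\<sigma> x)) (g - R (\<sigma> y)) = norm (R (\<sigma> x - \<sigma> y))"
      by (simp add: R \<sigma> dist_norm norm_minus_commute)
    also have "\<dots> \<le> q * norm (S (\<sigma> x - \<sigma> y))" by (intro small diff \<sigma>)
    finally show "dist (g - R (\<sigma> x)) (g - R (\<sigma> y)) \<le> q * dist x y"
      by (simp add: S \<sigma> dist_norm)
  qed
  then obtain f where "g - R (\<sigma> f) = f" by blast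
  hence "f + R (\<sigma> f) = g" unfolding diff_eq_eq by (rule sym)
  hence "S (\<sigma> f) + R (\<sigma> f) = g" unfolding \<sigma>(2) .
  thus ?thesis using \<sigma>(1) by blast
qed

lemma resolvent_setI:
  assumes S: "linear_op S" and onto: "\<And>y. \<exists>x\<in>dom_op S. S \<cdot> x - z *\<^sub>C x = y"
    and bound: "\<And>x. x \<in> dom_op S \<Longrightarrow> norm x \<le> M * norm (S \<cdot> x - z *\<^sub>C x)"
  shows "z \<in> resolvent_set S"
proof -
  note lin = linear_op_rules[OF S]
  have "inj_on (\<lambda>x. S \<cdot> x - z *\<^sub>C x) (dom_op S)"
  proof (rule inj_onI)
    fix x y assume xy: "x \<in> dom_op S" "y \<in> dom_op S" "S \<cdot> x - z *\<^sub>C x = S \<cdot> y - z *\<^sub>C y"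
    have "S \<cdot> (x - y) - z *\<^sub>C (x - y) = 0"
      using xy by (simp add: lin(5) scaleC_diff_right algebra_simps)
    thus "x = y" using bound[of "x - y"] xy csubspace_ops(3)[OF lin(1)] by simp
  qed
  moreover have "(\<lambda>x. S \<cdot> x - z *\<^sub>C x) ` dom_op S = UNIV"
    using onto by (auto simp: image_iff) metis
  ultimately show ?thesis using bound by (auto simp: resolvent_set_in_def bij_betw_def)
qed

lemma resolvent_props:
  assumes "z \<in> resolvent_set S"
  shows "resolvent S z x \<in> dom_op S" "S \<cdot> resolvent S z x - z *\<^sub>C resolvent S z x = x"
    and "u \<in> dom_op S \<Longrightarrow> S \<cdot> u - z *\<^sub>C u = x \<Longrightarrow> resolvent S z x = u"
proof -
  have bij: "bij_betw (\<lambda>x. S \<cdot> x - z *\<^sub>C x) (dom_op S) UNIV"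
    using assms by (simp add: resolvent_set_in_def)
  hence inj: "inj_on (\<lambda>x. S \<cdot> x - z *\<^sub>C x) (dom_op S)"
    and img: "(\<lambda>x. S \<cdot> x - z *\<^sub>C x) ` dom_op S = UNIV" by (auto simp: bij_betw_def)
  show "resolvent S z x \<in> dom_op S" unfolding resolvent_def
    by (rule the_inv_into_into[OF inj]) (auto simp: img)
  show "S \<cdot> resolvent S z x - z *\<^sub>C resolvent S z x = x" unfolding resolvent_def
    using f_the_inv_into_f[OF inj, of x] img by auto
  show "u \<in> dom_op S \<Longrightarrow> S \<cdot> u - z *\<^sub>C u = x \<Longrightarrow> resolvent S z x = u"
    unfolding resolvent_def using the_inv_into_f_f[OF inj] by metis
qed

lemma resolvent_bounded:
  assumes "z \<in> resolvent_set S"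
  obtains M where "M > 0" "\<And>x. norm (resolvent S z x) \<le> M * norm x"
proof -
  obtain M where M: "\<And>x. x \<in> dom_op S \<Longrightarrow> norm x \<le> M * norm (S \<cdot> x - z *\<^sub>C x)"
    using assms by (auto simp: resolvent_set_in_def)
  have "norm (resolvent S z x) \<le> (\<bar>M\<bar> + 1) * norm x" for x
  proof -
    have "norm (resolvent S z x) \<le> M * norm x"
      using M[OF resolvent_props(1)[OF assms]] by (simp add: resolvent_props(2)[OF assms])
    also have "\<dots> \<le> (\<bar>M\<bar> + 1) * norm x" by (intro mult_right_mono) auto
    finally show ?thesis .
  qed
  thus ?thesis using that[of "\<bar>M\<bar> + 1"] by simp
qed

lemma resolvent_linear:
  assumes S: "linear_op S" and z: "z \<in> resolvent_set S"
  shows "resolvent S z (x + y) = resolvent S z x + resolvent S z y"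
    and "resolvent S z (c *\<^sub>C x) = c *\<^sub>C resolvent S z x"
    and "resolvent S z (x - y) = resolvent S z x - resolvent S z y"
    and "bounded_linear (resolvent S z)"
proof -
  note lin = linear_op_rules[OF S] and r = resolvent_props[OF z]
  show add: "resolvent S z (x + y) = resolvent S z x + resolvent S z y" for x y
    by (rule r(3)) (auto simp: r lin(2) csubspace_ops(2)[OF lin(1)] scaleC_add_right
        add_diff_add intro!: arg_cong2[where f = "(+)"])
  show scale: "resolvent S z (c *\<^sub>C x) = c *\<^sub>C resolvent S z x" for c x
  proof (rule r(3))
    have "c *\<^sub>C (S \<cdot> resolvent S z x) - z *\<^sub>C c *\<^sub>C resolvent S z x
        = c *\<^sub>C (S \<cdot> resolvent S z x - z *\<^sub>C resolvent S z x)"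
      by (simp add: scaleC_diff_right scaleC_scaleC mult.commute)
    thus "S \<cdot> (c *\<^sub>C resolvent S z x) - z *\<^sub>C c *\<^sub>C resolvent S z x = c *\<^sub>C x"
      by (simp add: lin(3) r)
  qed (simp add: r csubspace_ops(4)[OF lin(1)])
  show "resolvent S z (x - y) = resolvent S z x - resolvent S z y"
    using add[of x "- y"] scale[of "-1" y] by (simp add: scaleC_minus_one)
  obtain M where "\<And>x. norm (resolvent S z x) \<le> M * norm x" using resolvent_bounded[OF z] by blast
  thus "bounded_linear (resolvent S z)"
    by (intro bounded_linear_intro[where K = M] add)
       (simp_all add: scale mult.commute flip: scaleC_of_real)
qed

lemma resolvent_identity:
  assumes S: "linear_op S" and z: "z \<in> resolvent_set S" and w: "w \<in> resolvent_set S"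
  shows "resolvent S z x - resolvent S w x = (z - w) *\<^sub>C resolvent S z (resolvent S w x)"
proof -
  note r = resolvent_props
  define y where "y = resolvent S w x"
  have y: "y \<in> dom_op S" "S \<cdot> y = x + w *\<^sub>C y" using r(1,2)[OF w, of x] by (auto simp: y_def algebra_simps)
  have "y = resolvent S z (S \<cdot> y - z *\<^sub>C y)" using r(3)[OF z y(1)] by simp
  also have "S \<cdot> y - z *\<^sub>C y = x - (z - w) *\<^sub>C y" by (simp add: y scaleC_diff_left algebra_simps)
  also have "resolvent S z \<dots> = resolvent S z x - (z - w) *\<^sub>C resolvent S z y"
    using resolvent_linear[OF S z] by simp
  finally show ?thesis by (simp add: y_def algebra_simps)
qed

text \<open>Near \<open>z\<close> the resolvents are uniformly bounded, because \<open>S - w\<close> differs from \<open>S - z\<close> by the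
  small multiple \<open>w - z\<close> of the identity.\<close>

lemma resolvent_locally_bounded:
  assumes S: "linear_op S" and z: "z \<in> resolvent_set S" and w: "w \<in> resolvent_set S"
    and M: "M > 0" "\<And>x. norm (resolvent S z x) \<le> M * norm x" and near: "cmod (w - z) \<le> 1 / (2 * M)"
  shows "norm (resolvent S w y) \<le> 2 * M * norm y"
proof -
  have "resolvent S w y = resolvent S z y + (w - z) *\<^sub>C resolvent S z (resolvent S w y)"
    using resolvent_identity[OF S z w, of y] by (simp add: scaleC_diff_left algebra_simps)
  hence "norm (resolvent S w y) \<le> norm (resolvent S z y)
      + cmod (w - z) * norm (resolvent S z (resolvent S w y))"
    by (metis norm_scaleC norm_triangle_ineq)
  also have "\<dots> \<le> M * norm y + (1 / (2 * M)) * (M * norm (resolvent S w y))"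
    using near M by (intro add_mono mult_mono) auto
  finally show ?thesis using M(1) by simp
qed

lemma resolvent_continuous:
  assumes S: "linear_op S" and Z: "Z \<subseteq> resolvent_set S"
  shows "continuous_on Z (\<lambda>z. resolvent S z x)"
  unfolding continuous_on_def
proof
  fix z assume "z \<in> Z"
  hence z: "z \<in> resolvent_set S" using Z by blast
  obtain M where M: "M > 0" "\<And>x. norm (resolvent S z x) \<le> M * norm x"
    using resolvent_bounded[OF z] by blast
  have est: "norm (resolvent S w x - resolvent S z x) \<le> cmod (w - z) * (2 * M * (M * norm x))"
    if w: "w \<in> resolvent_set S" and near: "cmod (w - z) < 1 / (2 * M)" for w
  proof -
    have "norm (resolvent S w x - resolvent S z x)
        = cmod (w - z) * norm (resolvent S w (resolvent S z x))"
      by (simp add: resolvent_identity[OF S w z] norm_scaleC)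
    also have "\<dots> \<le> cmod (w - z) * (2 * M * norm (resolvent S z x))"
      using near by (intro mult_left_mono resolvent_locally_bounded[OF S z w M]) auto
    also have "\<dots> \<le> cmod (w - z) * (2 * M * (M * norm x))"
      using M by (intro mult_left_mono M(2)) auto
    finally show ?thesis .
  qed
  have "((\<lambda>w. cmod (w - z) * (2 * M * (M * norm x))) \<longlongrightarrow> cmod (z - z) * (2 * M * (M * norm x)))
      (at z within Z)" by (intro tendsto_intros)
  hence "((\<lambda>w. cmod (w - z) * (2 * M * (M * norm x))) \<longlongrightarrow> 0) (at z within Z)" by simp
  moreover have "eventually (\<lambda>w. norm (resolvent S w x - resolvent S z x)
      \<le> cmod (w - z) * (2 * M * (M * norm x))) (at z within Z)"
    unfolding eventually_at
    by (rule exI[of _ "1 / (2 * M)"]) (use M est Z in \<open>auto simp: dist_norm\<close>)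
  ultimately have "((\<lambda>w. resolvent S w x - resolvent S z x) \<longlongrightarrow> 0) (at z within Z)"
    by (rule Lim_null_comparison[rotated])
  thus "((\<lambda>z. resolvent S z x) \<longlongrightarrow> resolvent S z x) (at z within Z)" by (rule LIM_zero_cancel)
qed

section \<open>Resolvents on the left half-plane\<close>

definition resolvent_decay :: "('a::complex_inner, 'a) operator \<Rightarrow> real \<Rightarrow> bool" where
  "resolvent_decay S K \<longleftrightarrow> (\<forall>z. Re z \<le> 0 \<longrightarrow> z \<in> resolvent_set S \<and>
     (\<forall>x. norm (resolvent S z x) \<le> K / (1 + cmod z) * norm x))"

lemma resolvent_decayD:
  assumes "resolvent_decay S K" "Re z \<le> 0"
  shows "z \<in> resolvent_set S" "norm (resolvent S z x) \<le> K / (1 + cmod z) * norm x"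
  using assms by (auto simp: resolvent_decay_def)

text \<open>Sectoriality provides the decay \<open>M / \<bar>z\<bar>\<close>, which is useless near the origin; there the
  resolvent is bounded because \<open>0\<close> is a regular point.\<close>

lemma sectorial_resolvent_decay:
  assumes A: "sectorial A \<theta>" "\<theta> < pi / 2" and zero: "0 \<in> resolvent_set A"
  obtains K where "K > 0" "resolvent_decay A K"
proof -
  have lin: "linear_op A" using A(1) by (auto simp: sectorial_def densely_defined_def)
  obtain M where M: "M > 0" and Mb: "\<And>z x. z \<noteq> 0 \<Longrightarrow> pi / 2 \<le> \<bar>Arg z\<bar> \<Longrightarrow>
      norm (resolvent A z x) \<le> M / norm z * norm x"
  proof -
    have "\<exists>M>0. \<forall>z. z \<noteq> 0 \<and> pi / 2 \<le> \<bar>Arg z\<bar> \<longrightarrow> (\<forall>x. norm (resolvent A z x) \<le> M / norm z * norm x)"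
    proof -
      have "\<theta> < pi / 2 \<and> pi / 2 \<le> pi" using A(2) pi_gt_zero by auto
      thus ?thesis using A(1) unfolding sectorial_def by blast
    qed
    thus ?thesis using that by blast
  qed
  have arg: "pi / 2 \<le> \<bar>Arg z\<bar>" if "Re z \<le> 0" "z \<noteq> 0" for z
    using Arg_Re_pos[of z] that by linarith
  have res: "z \<in> resolvent_set A" if "Re z \<le> 0" for z
  proof (cases "z = 0")
    case False
    hence "z \<notin> spectrum A" using arg[OF that] A by (auto simp: sectorial_def)
    thus ?thesis by (simp add: spectrum_in_def)
  qed (simp add: zero)
  obtain M0 where M0: "M0 > 0" "\<And>x. norm (resolvent A 0 x) \<le> M0 * norm x"
    using resolvent_bounded[OF zero] by blast
  \<comment> \<open>inside the disc of radius \<open>r\<close> the resolvent is compared with that at \<open>0\<close>, outside it the sectorial bound is used\<close>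
  define r where "r = 1 / (2 * M0)"
  have r: "r > 0" using M0(1) by (simp add: r_def)
  define K where "K = 2 * M0 * (1 + r) + M * (1 / r + 1)"
  have K: "2 * M0 * (1 + r) \<le> K" "M * (1 / r + 1) \<le> K" "K > 0"
  proof -
    have "2 * M0 * (1 + r) > 0" "M * (1 / r + 1) > 0"
      using M M0(1) r by (auto intro!: mult_pos_pos add_pos_pos)
    thus "2 * M0 * (1 + r) \<le> K" "M * (1 / r + 1) \<le> K" "K > 0" unfolding K_def by linarith+
  qed
  have "norm (resolvent A z x) \<le> K / (1 + cmod z) * norm x" if z: "Re z \<le> 0" for z x
  proof (cases "cmod z \<le> r")
    case True
    have "norm (resolvent A z x) \<le> 2 * M0 * norm x"
      using True by (intro resolvent_locally_bounded[OF lin zero res[OF z] M0]) (simp add: r_def)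
    also have "2 * M0 * (1 + cmod z) \<le> 2 * M0 * (1 + r)"
      using True M0(1) by (intro mult_left_mono) auto
    hence "2 * M0 \<le> K / (1 + cmod z)"
      using K(1) by (simp add: pos_le_divide_eq add_pos_nonneg)
    hence "2 * M0 * norm x \<le> K / (1 + cmod z) * norm x" by (rule mult_right_mono) simp
    finally show ?thesis .
  next
    case False
    hence z0: "z \<noteq> 0" "cmod z > 0" using r by auto
    have "norm (resolvent A z x) \<le> M / norm z * norm x" by (rule Mb[OF z0(1) arg[OF z z0(1)]])
    also have "1 / cmod z \<le> 1 / r" using False r by (simp add: frac_le)
    hence "M * (1 / cmod z + 1) \<le> K" using K(2) M
      by (intro order_trans[OF mult_left_mono K(2)]) auto
    hence M_le: "M * (1 + cmod z) \<le> K * cmod z" using z0 by (simp add: field_simps)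
    have "M / n \<le> K / (1 + n)" if "n > 0" "1 + n > 0" "M * (1 + n) \<le> K * n" for n
      using that by (simp add: divide_le_eq le_divide_eq)
    from this[OF z0(2) _ M_le] have "M / cmod z \<le> K / (1 + cmod z)"
      using z0(2) by (simp add: add_pos_pos)
    hence "M / cmod z * norm x \<le> K / (1 + cmod z) * norm x" by (rule mult_right_mono) simp
    finally show ?thesis .
  qed
  thus ?thesis using that[of K] K(3) res by (auto simp: resolvent_decay_def)
qed

text \<open>Cauchy's theorem on the left half-disc moves the integral over the segment to the
  semicircle, where \<open>- a / z\<close> contributes exactly \<open>\<pi> a\<close>.\<close>

lemma integral_imaginary_axis:
  fixes f :: "complex \<Rightarrow> complex"
  assumes hol: "f holomorphic_on {z. Re z \<le> 0}" and \<rho>: "\<rho> > 0" and e: "e \<ge> 0"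
    and arc: "\<And>z. Re z \<le> 0 \<Longrightarrow> cmod z = \<rho> \<Longrightarrow> cmod (f z + a / z) \<le> e"
  shows "cmod (integral {-\<rho>..\<rho>} (\<lambda>t. f (\<i> * of_real t)) - of_real pi * a) \<le> e * \<rho> * pi"
proof -
  define l where "l = linepath (- \<i> * of_real \<rho>) (\<i> * of_real \<rho>)"
  define c where "c = part_circlepath 0 \<rho> (pi / 2) (3 * pi / 2)"
  let ?H = "{z::complex. Re z \<le> 0}"
  have "3 * pi / 2 = pi + pi / 2" by simp
  hence cis: "cis (pi / 2) = \<i>" "cis (3 * pi / 2) = - \<i>"
    by (simp_all only: cis_mult[symmetric] cis_pi cis_pi_half) simp
  have ends: "pathstart l = - \<i> * of_real \<rho>" "pathfinish l = \<i> * of_real \<rho>"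
    "pathstart c = \<i> * of_real \<rho>" "pathfinish c = - \<i> * of_real \<rho>"
    using cis by (auto simp: l_def c_def cis_conv_exp mult.commute)
  have conv: "convex ?H" by (rule convex_halfspace_Re_le)
  have l_in: "path_image l \<subseteq> ?H" unfolding l_def path_image_linepath
    by (rule closed_segment_subset[OF _ _ conv]) auto
  have c_mem: "Re z \<le> 0 \<and> cmod z = \<rho>" if "z \<in> path_image c" for z
  proof -
    have "pi / 2 \<le> 3 * pi / 2" by simp
    from path_image_part_circlepath[OF this, of 0 \<rho>] that
    obtain x where x: "pi / 2 \<le> x" "x \<le> 3 * pi / 2" "z = of_real \<rho> * cis x"
      unfolding c_def by (auto simp: cis_conv_exp)
    have "cos x = - cos (x - pi)" by (simp add: cos_diff)
    moreover have "cos (x - pi) \<ge> 0" using x by (intro cos_ge_zero) auto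
    ultimately show ?thesis using x(3) \<rho> by (simp add: norm_mult mult_nonneg_nonpos)
  qed
  have c_in: "path_image c \<subseteq> ?H" using c_mem by blast
  have cont: "continuous_on ?H f" using hol by (rule holomorphic_on_imp_continuous_on)
  have int_l: "f contour_integrable_on l" unfolding l_def
    by (rule contour_integrable_continuous_linepath)
       (use continuous_on_subset[OF cont l_in] in \<open>simp add: l_def\<close>)
  have int_c: "f contour_integrable_on c" unfolding c_def
    by (rule contour_integrable_continuous_part_circlepath)
       (use continuous_on_subset[OF cont c_in] in \<open>simp add: c_def\<close>)
  have valid: "valid_path l" "valid_path c" by (auto simp: l_def c_def)
  have "(f has_contour_integral 0) (l +++ c)"
    using hol conv by (rule Cauchy_theorem_convex_simple)
      (use valid ends l_in c_in in \<open>auto simp: path_image_join\<close>)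
  hence sum0: "contour_integral l f + contour_integral c f = 0"
    using contour_integral_join[OF int_l int_c valid] contour_integral_unique by fastforce
  have line: "contour_integral l f = \<i> * integral {-\<rho>..\<rho>} (\<lambda>t. f (\<i> * of_real t))"
    unfolding l_def using \<rho>
    by (subst contour_integral_linepath_same_Re[where c = 0 and a = "-\<rho>" and b = \<rho>])
       (auto simp: Complex_eq)
  have inv: "((\<lambda>z. a / z) has_contour_integral (\<i> * of_real pi * a)) c"
  proof -
    have const: "((\<lambda>t. a * \<i>) has_integral (\<i> * of_real pi * a)) {pi / 2..3 * pi / 2}"
      using has_integral_const_real[of "a * \<i>" "pi / 2" "3 * pi / 2"]
      by (simp add: scaleR_conv_of_real mult_ac)
    have "(\<lambda>t. a / (0 + of_real \<rho> * cis t) * of_real \<rho> * \<i> * cis t) = (\<lambda>t. a * \<i>)"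
      using \<rho> by (simp add: fun_eq_iff field_simps)
    thus ?thesis unfolding c_def using const
      by (subst has_contour_integral_part_circlepath_iff) (simp_all only:, simp)
  qed
  have E: "((\<lambda>z. f z + a / z) has_contour_integral
      (contour_integral c f + \<i> * of_real pi * a)) c"
    by (rule has_contour_integral_add[OF has_contour_integral_integral[OF int_c] inv])
  have "cmod (contour_integral c f + \<i> * of_real pi * a) \<le> e * \<rho> * (3 * pi / 2 - pi / 2)"
    using E unfolding c_def by (rule has_contour_integral_bound_part_circlepath)
      (use \<rho> e arc c_mem in \<open>auto simp: c_def\<close>)
  moreover have "contour_integral c f + \<i> * of_real pi * a
      = - \<i> * (integral {-\<rho>..\<rho>} (\<lambda>t. f (\<i> * of_real t)) - of_real pi * a)"
    using sum0 line by (simp add: algebra_simps eq_neg_iff_add_eq_0)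
  ultimately show ?thesis by (simp add: norm_mult)
qed

lemma resolvent_cinner_holomorphic:
  assumes S: "linear_op S" and Z: "Z \<subseteq> resolvent_set S"
  shows "(\<lambda>z. cinner (resolvent S z u) v) holomorphic_on Z"
  unfolding holomorphic_on_def field_differentiable_def
proof
  fix z assume z: "z \<in> Z"
  let ?R = "\<lambda>w. resolvent S w (resolvent S z u)"
  have "((\<lambda>w. cinner (?R w) v) \<longlongrightarrow> cinner (?R z) v) (at z within Z)"
    using resolvent_continuous[OF S Z, of "resolvent S z u"] z
    by (intro bounded_linear.tendsto[OF bounded_linear_cinner_left]) (auto simp: continuous_on_def)
  moreover have "eventually (\<lambda>w. cinner (?R w) v =
      (cinner (resolvent S w u) v - cinner (resolvent S z u) v) / (w - z)) (at z within Z)"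
    unfolding eventually_at_filter
  proof (intro always_eventually allI impI)
    fix w assume w: "w \<noteq> z" "w \<in> Z"
    have "cinner (resolvent S w u - resolvent S z u) v = (w - z) * cinner (?R w) v"
    proof -
      have "resolvent S w u - resolvent S z u = (w - z) *\<^sub>C ?R w"
        using w z Z by (intro resolvent_identity[OF S]) auto
      thus ?thesis by (simp only: cinner_scaleC_left)
    qed
    thus "cinner (?R w) v = (cinner (resolvent S w u) v - cinner (resolvent S z u) v) / (w - z)"
      using w by (simp add: cinner_diff_left)
  qed
  ultimately have "((\<lambda>w. (cinner (resolvent S w u) v - cinner (resolvent S z u) v) / (w - z))
      \<longlongrightarrow> cinner (?R z) v) (at z within Z)" by (rule Lim_transform_eventually)
  thus "\<exists>d. ((\<lambda>z. cinner (resolvent S z u) v) has_field_derivative d) (at z within Z)"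
    unfolding has_field_derivative_iff by blast
qed

text \<open>On the domain of \<open>S\<close> one has \<open>R z u = - u / z + R z (S u) / z\<close>, so that the integrand is \<open>- u / z\<close> up
  to a term of second order.  The truncated integrals are uniformly bounded operators, so the
  limit extends to all of the space by density.\<close>

lemma resolvent_integral_limit:
  assumes S: "densely_defined S" and decay: "resolvent_decay S K"
  shows "((\<lambda>\<rho>. integral {-\<rho>..\<rho>} (\<lambda>t. cinner (resolvent S (\<i> * of_real t) u) v))
     \<longlongrightarrow> of_real pi * cinner u v) at_top"
proof -
  have lin: "linear_op S" and dense: "closure (dom_op S) = UNIV"
    using S by (auto simp: densely_defined_def)
  note dec = resolvent_decayD[OF decay]
  have H: "{z. Re z \<le> 0} \<subseteq> resolvent_set S" using dec(1) by auto
  have K: "0 \<le> K * norm x" for x :: 'a using order_trans[OF norm_ge_zero dec(2)[of 0 x]] by simp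
  define I where "I \<rho> u = integral {-\<rho>..\<rho>} (\<lambda>t. cinner (resolvent S (\<i> * of_real t) u) v)" for \<rho> u
  note hol = resolvent_cinner_holomorphic[OF lin H, of _ v]
  have bound: "cmod (I \<rho> u) \<le> K * norm u * norm v * pi" if "\<rho> > 0" for \<rho> u
  proof -
    have "cmod (I \<rho> u - of_real pi * 0) \<le> (K / (1 + \<rho>) * norm u * norm v) * \<rho> * pi"
      unfolding I_def
    proof (rule integral_imaginary_axis[OF hol that])
      show "0 \<le> K / (1 + \<rho>) * norm u * norm v" using K[of u] that by simp
      fix z assume z: "Re z \<le> 0" "cmod z = \<rho>"
      have "cmod (cinner (resolvent S z u) v) \<le> norm (resolvent S z u) * norm v"
        by (rule norm_cinner_le)
      also have "\<dots> \<le> K / (1 + \<rho>) * norm u * norm v"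
        using dec(2)[OF z(1)] z(2) by (intro mult_right_mono) auto
      finally show "cmod (cinner (resolvent S z u) v + 0 / z) \<le> K / (1 + \<rho>) * norm u * norm v"
        by simp
    qed
    also have "\<dots> = (K * norm u) * norm v * pi * (\<rho> / (1 + \<rho>))" by simp
    also have "\<dots> \<le> (K * norm u) * norm v * pi * 1"
      using K[of u] that by (intro mult_left_mono) auto
    finally show ?thesis by simp
  qed
  have core: "cmod (I \<rho> u - of_real pi * cinner u v) \<le> K * norm (S \<cdot> u) * norm v * pi / (1 + \<rho>)"
    if "\<rho> > 0" and u: "u \<in> dom_op S" for \<rho> u
  proof -
    have "cmod (I \<rho> u - of_real pi * cinner u v)
        \<le> (K / (1 + \<rho>) * norm (S \<cdot> u) * norm v / \<rho>) * \<rho> * pi"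
      unfolding I_def
    proof (rule integral_imaginary_axis[OF hol \<open>\<rho> > 0\<close>])
      show "0 \<le> K / (1 + \<rho>) * norm (S \<cdot> u) * norm v / \<rho>" using K[of "S \<cdot> u"] \<open>\<rho> > 0\<close> by simp
      fix z assume z: "Re z \<le> 0" "cmod z = \<rho>"
      have "u = resolvent S z (S \<cdot> u - z *\<^sub>C u)" using resolvent_props(3)[OF dec(1)[OF z(1)] u] by simp
      also have "\<dots> = resolvent S z (S \<cdot> u) - z *\<^sub>C resolvent S z u"
        by (simp add: resolvent_linear[OF lin dec(1)[OF z(1)]])
      finally have "cinner u v = cinner (resolvent S z (S \<cdot> u) - z *\<^sub>C resolvent S z u) v"
        by (rule arg_cong)
      hence uv: "cinner u v = cinner (resolvent S z (S \<cdot> u)) v - z * cinner (resolvent S z u) v"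
        by (simp only: cinner_diff_left cinner_scaleC_left)
      have "cinner (resolvent S z u) v + cinner u v / z = cinner (resolvent S z (S \<cdot> u)) v / z"
      proof -
        have "z \<noteq> 0" using z(2) \<open>\<rho> > 0\<close> by auto
        thus ?thesis by (simp add: uv diff_divide_distrib)
      qed
      hence "cmod (cinner (resolvent S z u) v + cinner u v / z)
          = cmod (cinner (resolvent S z (S \<cdot> u)) v) / \<rho>" by (simp add: norm_divide z(2))
      also have "\<dots> \<le> norm (resolvent S z (S \<cdot> u)) * norm v / \<rho>"
        using \<open>\<rho> > 0\<close> by (intro divide_right_mono norm_cinner_le) auto
      also have "\<dots> \<le> K / (1 + \<rho>) * norm (S \<cdot> u) * norm v / \<rho>"
        using dec(2)[OF z(1)] z(2) \<open>\<rho> > 0\<close> by (intro divide_right_mono mult_right_mono) auto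
      finally show "cmod (cinner (resolvent S z u) v + cinner u v / z)
          \<le> K / (1 + \<rho>) * norm (S \<cdot> u) * norm v / \<rho>" .
    qed
    thus ?thesis using \<open>\<rho> > 0\<close> by simp
  qed
  have I_diff: "I \<rho> (u - u') = I \<rho> u - I \<rho> u'" for \<rho> u u'
  proof -
    have int: "(\<lambda>t. cinner (resolvent S (\<i> * of_real t) u) v) integrable_on {-\<rho>..\<rho>}" for u
    proof (rule integrable_continuous_interval)
      show "continuous_on {-\<rho>..\<rho>} (\<lambda>t. cinner (resolvent S (\<i> * of_real t) u) v)"
        by (rule continuous_on_compose2[OF holomorphic_on_imp_continuous_on[OF hol]])
           (auto intro!: continuous_intros)
    qed
    have "resolvent S (\<i> * of_real t) (u - u') = resolvent S (\<i> * of_real t) u - resolvent S (\<i> * of_real t) u'"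
      for t using resolvent_linear(3)[OF lin dec(1)] by simp
    thus ?thesis unfolding I_def by (simp add: cinner_diff_left integral_diff int)
  qed
  show ?thesis unfolding I_def[symmetric]
  proof (rule tendstoI)
    fix e :: real assume e: "e > 0"
    define m where "m = (K * norm v + norm v) * pi + 1"
    have m: "m > 0" using K[of v] by (simp add: m_def add_nonneg_pos)
    obtain u' where u': "u' \<in> dom_op S" "dist u' u < e / 2 / m"
    proof -
      have "u \<in> closure (dom_op S)" "e / 2 / m > 0" using dense e m by auto
      thus ?thesis using that unfolding closure_approachable by blast
    qed
    have small: "m * norm (u - u') < e / 2"
      using u'(2) m by (simp add: dist_norm norm_minus_commute field_simps)
    have "((\<lambda>\<rho>. K * norm (S \<cdot> u') * norm v * pi / (1 + \<rho>)) \<longlongrightarrow> 0) at_top"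
      by (rule real_tendsto_divide_at_top[OF tendsto_const
            filterlim_tendsto_add_at_top[OF tendsto_const filterlim_ident]])
    hence "eventually (\<lambda>\<rho>. K * norm (S \<cdot> u') * norm v * pi / (1 + \<rho>) < e / 2) at_top"
      using e by (intro order_tendstoD) auto
    thus "eventually (\<lambda>\<rho>. dist (I \<rho> u) (of_real pi * cinner u v) < e) at_top"
      using eventually_gt_at_top[of 0]
    proof eventually_elim
      case (elim \<rho>)
      have "I \<rho> u - of_real pi * cinner u v
          = I \<rho> (u - u') + (I \<rho> u' - of_real pi * cinner u' v) - of_real pi * cinner (u - u') v"
        by (simp add: I_diff cinner_diff_left algebra_simps)
      hence "cmod (I \<rho> u - of_real pi * cinner u v) \<le> cmod (I \<rho> (u - u'))
          + cmod (I \<rho> u' - of_real pi * cinner u' v) + cmod (of_real pi * cinner (u - u') v)"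
        by (simp only:) (rule order_trans[OF norm_triangle_ineq4 add_right_mono[OF norm_triangle_ineq]])
      also have "\<dots> \<le> K * norm (u - u') * norm v * pi
          + K * norm (S \<cdot> u') * norm v * pi / (1 + \<rho>) + pi * (norm (u - u') * norm v)"
        using norm_cinner_le[of "u - u'" v]
        by (intro add_mono bound core elim u') (auto simp: norm_mult)
      also have "\<dots> = (m - 1) * norm (u - u') + K * norm (S \<cdot> u') * norm v * pi / (1 + \<rho>)"
        by (simp add: m_def algebra_simps)
      also have "\<dots> \<le> m * norm (u - u') + K * norm (S \<cdot> u') * norm v * pi / (1 + \<rho>)"
        by (simp add: mult_right_mono)
      also have "\<dots> < e" using small elim by linarith
      finally show ?case by (simp add: dist_norm)
    qed
  qed
qed

text \<open>By Riesz, the bounded operator \<open>R = (S - z)\<^sup>-\<^sup>1\<close> has an adjoint, which inverts \<open>S\<^sup>* - cnj z\<close>.\<close>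

lemma adj_resolvent:
  fixes S :: "('a::complex_hilbert, 'a) operator"
  assumes S: "densely_defined S" and z: "z \<in> resolvent_set S"
    and m: "\<And>x. norm (resolvent S z x) \<le> m * norm x"
  obtains x where "x \<in> dom_op (adj S)" "adj S \<cdot> x - cnj z *\<^sub>C x = y" "norm x \<le> m * norm y"
    "\<And>f. cinner (resolvent S z f) y = cinner f x"
proof -
  have lin: "linear_op S" using S by (simp add: densely_defined_def)
  note rl = resolvent_linear[OF lin z]
  obtain x where x: "\<And>f. cinner (resolvent S z f) y = cinner f x"
    using riesz_complex[of "\<lambda>f. cinner (resolvent S z f) y"] rl
      bounded_linear_compose[OF bounded_linear_cinner_left rl(4)]
    by (auto simp: cinner_scaleC_left)
  have "cinner (S \<cdot> u) x = cinner u (y + cnj z *\<^sub>C x)" if "u \<in> dom_op S" for u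
  proof -
    have "cinner (S \<cdot> u - z *\<^sub>C u) x = cinner u y"
      using x[of "S \<cdot> u - z *\<^sub>C u"] resolvent_props(3)[OF z that] by simp
    thus ?thesis by (simp add: cinner_algebra algebra_simps)
  qed
  hence adj: "x \<in> dom_op (adj S)" "adj S \<cdot> x - cnj z *\<^sub>C x = y" using adjI[OF S] by auto
  have "norm x * norm x = Re (cinner (resolvent S z x) y)"
    by (simp add: x Re_cinner_self power2_eq_square)
  also have "\<dots> \<le> norm (resolvent S z x) * norm y" by (rule Re_cinner_le)
  also have "\<dots> \<le> m * norm x * norm y" by (intro mult_right_mono m) simp
  finally have "norm x * norm x \<le> norm x * (m * norm y)" by (simp add: mult_ac)
  moreover have "0 \<le> m * norm y" using m[of y] norm_ge_zero order_trans by blast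
  ultimately have "norm x \<le> m * norm y" by (cases "x = 0") auto
  thus ?thesis using that adj x by blast
qed

section \<open>Spectral projections of a dichotomous operator\<close>

lemma proj_along_eq:
  assumes "csubspace V" "csubspace W" "V \<inter> W = {0}" "v \<in> V" "w \<in> W"
  shows "proj_along V W (v + w) = v"
  unfolding proj_along_def
proof (rule the_equality)
  fix v' assume v': "v' \<in> V \<and> v + w - v' \<in> W"
  hence "v + w - v' - w \<in> W" using assms csubspace_ops(3) by blast
  hence "v - v' \<in> V \<inter> W" using assms(1,4) v' csubspace_ops(3) by (auto simp: algebra_simps)
  thus "v' = v" using assms(3) by auto
qed (use assms in auto)

lemma complementary_proj:
  assumes "complementary V W"
  shows "proj_along V W x \<in> V" "proj_along W V x \<in> W" "proj_along V W x + proj_along W V x = x"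
    "x \<in> V \<Longrightarrow> proj_along V W x = x" "x \<in> V \<Longrightarrow> proj_along W V x = 0"
proof -
  have sub: "csubspace V" "csubspace W" "V \<inter> W = {0}" "W \<inter> V = {0}"
    using assms by (auto simp: complementary_def)
  have zero: "0 \<in> V" "0 \<in> W" using sub csubspace_ops(1) by blast+
  have "\<exists>v\<in>V. \<exists>w\<in>W. x = v + w" using assms by (simp add: complementary_def)
  then obtain v w where vw: "v \<in> V" "w \<in> W" "x = v + w" by blast
  have pv: "proj_along V W x = v" using proj_along_eq[OF sub(1-3) vw(1,2)] vw(3) by simp
  have pw: "proj_along W V x = w"
    using proj_along_eq[OF sub(2,1,4) vw(2,1)] vw(3) by (simp add: add.commute)
  show "proj_along V W x \<in> V" "proj_along W V x \<in> W" "proj_along V W x + proj_along W V x = x"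
    using pv pw vw by auto
  show "x \<in> V \<Longrightarrow> proj_along V W x = x" using proj_along_eq[OF sub(1-3) _ zero(2), of x] by simp
  show "x \<in> V \<Longrightarrow> proj_along W V x = 0" using proj_along_eq[OF sub(2,1,4) zero(2), of x] by simp
qed

lemma spectral_subspaces_dichotomous:
  assumes "spectral_subspaces S Vp Vm"
  shows "densely_defined S" "linear_op S" "complementary Vp Vm"
    "\<And>t. \<i> * of_real t \<in> resolvent_set S"
    "\<And>w. w \<in> dom_op S \<inter> Vp \<Longrightarrow> S \<cdot> w \<in> Vp"
    "\<And>z. Re z \<le> 0 \<Longrightarrow> z \<in> resolvent_set_in Vp (restrict_op S Vp)"
proof -
  have d: "dichotomous_wrt S Vp Vm" using assms by (simp add: spectral_subspaces_def)
  thus "densely_defined S" "linear_op S" "complementary Vp Vm"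
    by (auto simp: dichotomous_wrt_def densely_defined_def)
  obtain h where "h > 0" "{z. \<bar>Re z\<bar> < h} \<subseteq> resolvent_set S"
    using d by (auto simp: dichotomous_wrt_def)
  thus "\<i> * of_real t \<in> resolvent_set S" for t by auto
  show "w \<in> dom_op S \<inter> Vp \<Longrightarrow> S \<cdot> w \<in> Vp" for w using d by (auto simp: dichotomous_wrt_def)
  have "spectrum_in Vp (restrict_op S Vp) \<subseteq> {z. Re z > 0}"
    using d by (simp add: dichotomous_wrt_def)
  thus "Re z \<le> 0 \<Longrightarrow> z \<in> resolvent_set_in Vp (restrict_op S Vp)" for z
    by (force simp: spectrum_in_def)
qed

lemma spectral_subspaces_continuous:
  assumes "spectral_subspaces S Vp Vm"
  shows "continuous_on X (\<lambda>t. resolvent S (\<i> * of_real t) x)"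
proof -
  note d = spectral_subspaces_dichotomous[OF assms]
  have "continuous_on (range (\<lambda>t. \<i> * of_real t)) (\<lambda>z. resolvent S z x)"
    using d(4) by (intro resolvent_continuous[OF d(2)]) auto
  thus ?thesis by (rule continuous_on_compose2) (auto intro!: continuous_intros)
qed

text \<open>Pairing with a fixed vector makes the defining integral of the spectral projections comparable with
  the scalar integrals that Cauchy's theorem evaluates.\<close>

lemma spectral_subspaces_integral:
  assumes "spectral_subspaces S Vp Vm"
  shows "((\<lambda>\<rho>. integral {-\<rho>..\<rho>} (\<lambda>t. cinner (resolvent S (\<i> * of_real t) x) y))
    \<longlongrightarrow> of_real pi * cinner (proj_along Vp Vm x - proj_along Vm Vp x) y) at_top"
proof -
  let ?R = "\<lambda>t. resolvent S (\<i> * of_real t) x"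
  have int: "?R integrable_on {-\<rho>..\<rho>}" for \<rho>
    by (rule integrable_continuous_interval[OF spectral_subspaces_continuous[OF assms]])
  have "of_real pi * cinner ((1 / (of_real pi * \<i>)) *\<^sub>C integral {-\<rho>..\<rho>} (\<lambda>t. \<i> *\<^sub>C ?R t)) y
      = integral {-\<rho>..\<rho>} (\<lambda>t. cinner (?R t) y)" for \<rho>
  proof -
    have "integral {-\<rho>..\<rho>} (\<lambda>t. \<i> *\<^sub>C ?R t) = \<i> *\<^sub>C integral {-\<rho>..\<rho>} ?R"
      using integral_linear[OF int bounded_linear_scaleC_right] by (simp add: o_def)
    moreover have "integral {-\<rho>..\<rho>} (\<lambda>t. cinner (?R t) y) = cinner (integral {-\<rho>..\<rho>} ?R) y"
      using integral_linear[OF int bounded_linear_cinner_left] by (simp add: o_def)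
    ultimately show ?thesis by (simp add: cinner_scaleC_left)
  qed
  moreover have "((\<lambda>\<rho>. of_real pi * cinner ((1 / (of_real pi * \<i>)) *\<^sub>C
        integral {-\<rho>..\<rho>} (\<lambda>t. \<i> *\<^sub>C ?R t)) y)
      \<longlongrightarrow> of_real pi * cinner (proj_along Vp Vm x - proj_along Vm Vp x) y) at_top"
    using assms unfolding spectral_subspaces_def
    by (intro tendsto_mult_left bounded_linear.tendsto[OF bounded_linear_cinner_left]) blast
  ultimately show ?thesis by simp
qed

section \<open>Bounded quadratic forms and an integrable weight\<close>

text \<open>By Cauchy-Schwarz for the form, \<open>X\<close> is bounded on its domain; as it is closed and densely defined, the
  domain is everything.\<close>

lemma bounded_form_imp_bounded:
  fixes X :: "('a::complex_hilbert, 'a) operator"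
  assumes X: "symmetric_op X" "nonneg_op X" and closed: "closed (graph X)"
    and form: "\<And>u. u \<in> dom_op X \<Longrightarrow> Re (cinner (X \<cdot> u) u) \<le> G * (norm u)\<^sup>2"
    and G: "G \<ge> 0"
  shows "dom_op X = UNIV \<and> bounded_clinear (app X)"
proof -
  note lin = linear_op_rules[OF symmetric_op_linear[OF X(1)]]
  have dense: "closure (dom_op X) = UNIV"
    using X(1) by (simp add: symmetric_op_def densely_defined_def)
  have bound: "norm (X \<cdot> u) \<le> G * norm u" if u: "u \<in> dom_op X" for u
  proof -
    let ?N = "{y. Re (cinner (X \<cdot> u) y) \<le> G * norm u * norm y}"
    have "dom_op X \<subseteq> ?N"
    proof
      fix y assume y: "y \<in> dom_op X"
      have "(Re (cinner (X \<cdot> u) y))\<^sup>2 \<le> Re (cinner (X \<cdot> u) u) * Re (cinner (X \<cdot> y) y)"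
        by (rule nonneg_op_cauchy_schwarz[OF X u y])
      also have "\<dots> \<le> (G * (norm u)\<^sup>2) * (G * (norm y)\<^sup>2)"
        using u y G nonneg_op_Re[OF X(2)] by (intro mult_mono form) auto
      also have "\<dots> = (G * norm u * norm y)\<^sup>2" by (simp add: power2_eq_square)
      finally show "y \<in> ?N" using G by (auto intro: power2_le_imp_le)
    qed
    moreover have "closed ?N" unfolding Re_cinner
      by (intro closed_Collect_le continuous_intros)
    ultimately have "closure (dom_op X) \<subseteq> ?N" by (rule closure_minimal)
    hence "Re (cinner (X \<cdot> u) (X \<cdot> u)) \<le> G * norm u * norm (X \<cdot> u)" using dense by auto
    hence "norm (X \<cdot> u) * norm (X \<cdot> u) \<le> (G * norm u) * norm (X \<cdot> u)"
      by (simp add: Re_cinner_self power2_eq_square)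
    thus ?thesis using G by (cases "X \<cdot> u = 0") auto
  qed
  have UNIV: "dom_op X = UNIV"
  proof (intro equalityI subset_UNIV subsetI)
    fix u :: 'a
    obtain s where s: "\<And>n. s n \<in> dom_op X" "s \<longlonglongrightarrow> u"
      using dense closure_sequential[of u "dom_op X"] by auto
    have Cauchy_X: "Cauchy (\<lambda>n. X \<cdot> s n)"
    proof (rule CauchyI)
      fix e :: real assume e: "e > 0"
      have "Cauchy s" using s(2) by (rule LIMSEQ_imp_Cauchy)
      moreover have "e / (G + 1) > 0" using e G by simp
      ultimately obtain N where N: "\<And>m n. m \<ge> N \<Longrightarrow> n \<ge> N \<Longrightarrow> norm (s m - s n) < e / (G + 1)"
        using CauchyD by blast
      have "norm (X \<cdot> s m - X \<cdot> s n) < e" if "m \<ge> N" "n \<ge> N" for m n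
      proof -
        have "norm (X \<cdot> s m - X \<cdot> s n) \<le> G * norm (s m - s n)"
          using bound[of "s m - s n"] s(1) lin(5) csubspace_ops(3)[OF lin(1)] by simp
        also have "\<dots> \<le> (G + 1) * norm (s m - s n)" by (intro mult_right_mono) auto
        also have "\<dots> < (G + 1) * (e / (G + 1))"
          using G that by (intro mult_strict_left_mono N) auto
        finally show ?thesis using G by simp
      qed
      thus "\<exists>M. \<forall>m\<ge>M. \<forall>n\<ge>M. norm (X \<cdot> s m - X \<cdot> s n) < e" by blast
    qed
    then obtain w where w: "(\<lambda>n. X \<cdot> s n) \<longlonglongrightarrow> w"
      using Cauchy_convergent[OF Cauchy_X] by (auto simp: convergent_def)
    have "(s n, X \<cdot> s n) \<in> graph X" for n using s(1) by (auto simp: graph_def)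
    from closed_sequentially[OF closed this tendsto_Pair[OF s(2) w]] have "(u, w) \<in> graph X" .
    thus "u \<in> dom_op X" by (auto simp: graph_def)
  qed
  have "bounded_linear (app X)"
  proof (rule bounded_linear_intro[where K = G])
    show "X \<cdot> (x + y) = X \<cdot> x + X \<cdot> y" for x y using lin(2) UNIV by simp
    show "X \<cdot> (r *\<^sub>R x) = r *\<^sub>R (X \<cdot> x)" for r x
      using lin(3)[of x "of_real r"] UNIV by (simp add: scaleC_of_real)
    show "norm (X \<cdot> x) \<le> norm x * G" for x using bound[of x] UNIV by (simp add: mult.commute)
  qed
  thus ?thesis using UNIV lin(3) by (simp add: bounded_clinear_def)
qed

lemma integral_weight_bound:
  fixes p :: real
  assumes "p < 1" "\<rho> \<ge> 0"
  shows "(\<lambda>t. (1 + \<bar>t\<bar>) powr (p - 2)) integrable_on {-\<rho>..\<rho>}"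
    and "integral {-\<rho>..\<rho>} (\<lambda>t. (1 + \<bar>t\<bar>) powr (p - 2)) \<le> 2 / (1 - p)"
proof -
  let ?w = "\<lambda>t. (1 + \<bar>t\<bar>) powr (p - 2)"
  show int: "?w integrable_on {-\<rho>..\<rho>}"
    by (rule integrable_continuous_interval) (auto intro!: continuous_intros simp: add_nonneg_eq_0_iff)
  have "((\<lambda>t. (1 + t) powr (p - 2)) has_integral
      (1 + \<rho>) powr (p - 1) / (p - 1) - (1 + 0) powr (p - 1) / (p - 1)) {0..\<rho>}"
  proof (rule fundamental_theorem_of_calculus[OF assms(2)])
    fix t assume t: "t \<in> {0..\<rho>}"
    have "((\<lambda>t. (1 + t) powr (p - 1) / (p - 1)) has_real_derivative (1 + t) powr (p - 2))
        (at t within {0..\<rho>})"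
      using t assms(1) by (auto intro!: derivative_eq_intros)
    thus "((\<lambda>t. (1 + t) powr (p - 1) / (p - 1)) has_vector_derivative (1 + t) powr (p - 2))
        (at t within {0..\<rho>})" by (simp add: has_real_derivative_iff_has_vector_derivative)
  qed
  hence "integral {0..\<rho>} (\<lambda>t. (1 + t) powr (p - 2)) = (1 - (1 + \<rho>) powr (p - 1)) / (1 - p)"
    using assms(1) by (simp add: integral_unique diff_divide_distrib[symmetric]
        minus_divide_divide[of _ "p - 1", symmetric])
  also have "\<dots> \<le> 1 / (1 - p)" using assms(1) by (intro divide_right_mono) auto
  finally have half: "integral {0..\<rho>} (\<lambda>t. (1 + t) powr (p - 2)) \<le> 1 / (1 - p)" .
  have pos: "integral {0..\<rho>} ?w = integral {0..\<rho>} (\<lambda>t. (1 + t) powr (p - 2))"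
    by (rule integral_cong) auto
  have neg: "integral {-\<rho>..0} ?w = integral {0..\<rho>} ?w"
    using Henstock_Kurzweil_Integration.integral_reflect_real[of \<rho> 0 ?w] by simp
  have "integral {-\<rho>..0} ?w + integral {0..\<rho>} ?w = integral {-\<rho>..\<rho>} ?w"
    using assms(2) int by (intro Henstock_Kurzweil_Integration.integral_combine) auto
  thus "integral {-\<rho>..\<rho>} ?w \<le> 2 / (1 - p)" using half pos neg by simp
qed

section \<open>Hamiltonians with sectorial diagonal\<close>

text \<open>The constants \<open>cB\<close> and \<open>cC\<close> express the subordination of \<open>B\<close> to the adjoint of \<open>A\<close> and of \<open>C\<close> to \<open>A\<close> in the additive
  form of \<open>subordinate_additive\<close>; \<open>K\<close> is the decay constant of the resolvent of \<open>A\<close>.\<close>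

locale sectorial_hamiltonian =
  fixes A B C :: "('a::complex_hilbert, 'a) operator" and p K cB cC :: real
  assumes A: "densely_defined A" and decay: "resolvent_decay A K" and K: "K > 0"
    and B: "symmetric_op B" "nonneg_op B" and C: "symmetric_op C" "nonneg_op C"
    and p: "p < 1"
    and domB: "dom_op (adj A) \<subseteq> dom_op B" and domC: "dom_op A \<subseteq> dom_op C"
    and cB: "cB \<ge> 0" "\<And>s y. s > 0 \<Longrightarrow> y \<in> dom_op (adj A) \<Longrightarrow>
      norm (B \<cdot> y) \<le> cB * s powr (p - 1) * (s * norm y + norm (adj A \<cdot> y))"
    and cC: "cC \<ge> 0" "\<And>s x. s > 0 \<Longrightarrow> x \<in> dom_op A \<Longrightarrow>
      norm (C \<cdot> x) \<le> cC * s powr (p - 1) * (s * norm x + norm (A \<cdot> x))"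
begin

lemma lin: "linear_op A" "linear_op B" "linear_op C" "linear_op (adj A)"
  using A B C linear_op_adj symmetric_op_linear by (auto simp: densely_defined_def)

lemmas linA = linear_op_rules[OF lin(1)] and linB = linear_op_rules[OF lin(2)]
  and lin_adj = linear_op_rules[OF lin(4)]

lemma dom_ham: "dom_op (ham A B C) = dom_op A \<times> dom_op (adj A)"
  using domB domC by (auto simp: ham_def)

lemma ham_apply: "ham A B C \<cdot> (x, y) = (A \<cdot> x + B \<cdot> y, C \<cdot> x - adj A \<cdot> y)"
  by (simp add: ham_def)

lemma adjD': "u \<in> dom_op A \<Longrightarrow> v \<in> dom_op (adj A) \<Longrightarrow> cinner (A \<cdot> u) v = cinner u (adj A \<cdot> v)"
  using adjD[OF A] by blast

lemma half_plane_estimate: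
  assumes u: "u \<in> dom_op A" and z: "Re z \<le> 0"
  shows "norm u \<le> K / (1 + cmod z) * norm (A \<cdot> u - z *\<^sub>C u)"
    and "norm (A \<cdot> u) \<le> (1 + K) * norm (A \<cdot> u - z *\<^sub>C u)"
proof -
  let ?g = "A \<cdot> u - z *\<^sub>C u"
  note d = resolvent_decayD[OF decay z]
  have "resolvent A z ?g = u" using resolvent_props(3)[OF d(1) u] by simp
  thus 1: "norm u \<le> K / (1 + cmod z) * norm ?g" using d(2)[of ?g] by simp
  have "norm (A \<cdot> u) = norm (?g + z *\<^sub>C u)" by simp
  also have "\<dots> \<le> norm ?g + cmod z * norm u" by (rule norm_add_scaleC_le)
  also have "\<dots> \<le> norm ?g + cmod z * (K / (1 + cmod z) * norm ?g)"
    by (intro add_left_mono mult_left_mono 1) auto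
  also have "cmod z * (K / (1 + cmod z) * norm ?g) = cmod z / (1 + cmod z) * (K * norm ?g)" by simp
  also have "\<dots> \<le> 1 * (K * norm ?g)"
    using K by (intro mult_right_mono) (auto simp: divide_le_eq_1 add_pos_nonneg)
  finally show "norm (A \<cdot> u) \<le> (1 + K) * norm ?g" by (simp add: algebra_simps)
qed

text \<open>For \<open>u = (A - z)\<^sup>-\<^sup>1 g\<close> with imaginary \<open>z\<close> this bounds the running cost of the trajectory without control.
  Of the exponent \<open>p - 2\<close>, the part \<open>p - 1\<close> comes from the subordination of \<open>C\<close> and the remaining \<open>- 1\<close> from the
  decay of \<open>u\<close>; it is below \<open>- 1\<close>, so the cost is integrable.\<close>

lemma C_resolvent_form:
  assumes u: "u \<in> dom_op A" and z: "Re z \<le> 0"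
  shows "Re (cinner (C \<cdot> u) u)
    \<le> cC * (1 + 2 * K) * K * (1 + cmod z) powr (p - 2) * (norm (A \<cdot> u - z *\<^sub>C u))\<^sup>2"
proof -
  define n s where "n = norm (A \<cdot> u - z *\<^sub>C u)" and "s = 1 + cmod z"
  have s: "s > 0" by (simp add: s_def add_pos_nonneg)
  note est = half_plane_estimate[OF u z, folded n_def s_def]
  have "s * norm u \<le> s * (K / s * n)" using s by (intro mult_left_mono est) auto
  hence "s * norm u + norm (A \<cdot> u) \<le> (1 + 2 * K) * n" using est(2) s by (simp add: algebra_simps)
  hence "norm (C \<cdot> u) \<le> cC * s powr (p - 1) * ((1 + 2 * K) * n)"
    by (intro order_trans[OF cC(2)[OF s u]] mult_left_mono) (auto simp: cC)
  hence "norm (C \<cdot> u) * norm u \<le> cC * s powr (p - 1) * ((1 + 2 * K) * n) * (K / s * n)"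
    using cC(1) K by (intro mult_mono est) (auto simp: n_def)
  also have "\<dots> = cC * (1 + 2 * K) * K * (s powr (p - 1) / s) * n\<^sup>2" by (simp add: power2_eq_square)
  also have "s powr (p - 1) / s = s powr (p - 2)"
    using s powr_diff[of s "p - 1" 1] by (simp add: algebra_simps)
  finally show ?thesis using Re_cinner_le[of "C \<cdot> u" u] by (simp add: n_def s_def)
qed

text \<open>\<open>(A - z)\<^sup>-\<^sup>1 B v\<close> is controlled by the form of \<open>B\<close> alone: test it with a vector \<open>x\<close>, move the resolvent to
  the other side, where it maps into the domain of \<open>B\<close>, and use Cauchy-Schwarz for \<open>B\<close>.\<close>

lemma resolvent_B_form:
  assumes v: "v \<in> dom_op (adj A)" and z: "Re z \<le> 0"
  shows "(norm (resolvent A z (B \<cdot> v)))\<^sup>2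
    \<le> cB * (1 + 2 * K) * K / (1 + cmod z) * Re (cinner (B \<cdot> v) v)"
proof -
  define s where "s = 1 + cmod z"
  have s: "s \<ge> 1" by (simp add: s_def)
  define D where "D = cB * (1 + 2 * K) * K / s"
  have D: "D \<ge> 0" using cB(1) K s by (simp add: D_def)
  note d = resolvent_decayD[OF decay z]
  define y where "y = resolvent A z (B \<cdot> v)"
  obtain x where x: "x \<in> dom_op (adj A)" "adj A \<cdot> x - cnj z *\<^sub>C x = y"
    "norm x \<le> K / s * norm y" "\<And>f. cinner (resolvent A z f) y = cinner f x"
    using adj_resolvent[OF A d(1), of "K / s" y] d(2) by (auto simp: s_def)
  have "cmod z * norm x \<le> s * (K / s * norm y)"
    using s x(3) by (intro mult_mono) (auto simp: s_def)
  hence zx: "cmod z * norm x \<le> K * norm y" using s by simp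
  have "norm (adj A \<cdot> x) = norm (y + cnj z *\<^sub>C x)" using x(2) by (simp add: algebra_simps)
  also have "\<dots> \<le> norm y + cmod z * norm x" using norm_add_scaleC_le[of y "cnj z" x] by simp
  finally have Ax: "norm (adj A \<cdot> x) \<le> (1 + K) * norm y" using zx by (simp add: algebra_simps)
  have "s * norm x \<le> s * (K / s * norm y)" using s x(3) by (intro mult_left_mono) auto
  hence "s * norm x + norm (adj A \<cdot> x) \<le> (1 + 2 * K) * norm y"
    using Ax s by (simp add: algebra_simps)
  moreover have "s powr (p - 1) \<le> 1" using s p powr_mono[of "p - 1" 0 s] by simp
  ultimately have "cB * s powr (p - 1) * (s * norm x + norm (adj A \<cdot> x))
      \<le> cB * 1 * ((1 + 2 * K) * norm y)"
    using cB(1) s K by (intro mult_mono) auto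
  hence "norm (B \<cdot> x) \<le> cB * ((1 + 2 * K) * norm y)" using cB(2)[of s x] x(1) s by simp
  hence "norm (B \<cdot> x) * norm x \<le> cB * ((1 + 2 * K) * norm y) * (K / s * norm y)"
    using cB(1) K by (intro mult_mono x(3)) auto
  also have "\<dots> = D * (norm y)\<^sup>2" by (simp add: D_def power2_eq_square)
  finally have Bx: "Re (cinner (B \<cdot> x) x) \<le> D * (norm y)\<^sup>2"
    using Re_cinner_le[of "B \<cdot> x" x] by linarith
  define \<beta> where "\<beta> = Re (cinner (B \<cdot> v) v)"
  have \<beta>: "\<beta> \<ge> 0" using nonneg_op_Re[OF B(2)] v domB by (auto simp: \<beta>_def)
  have "((norm y)\<^sup>2)\<^sup>2 = (Re (cinner (B \<cdot> v) x))\<^sup>2"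
    by (simp add: x(4)[symmetric] y_def Re_cinner_self)
  also have "\<dots> \<le> \<beta> * Re (cinner (B \<cdot> x) x)"
    unfolding \<beta>_def using v x(1) domB by (intro nonneg_op_cauchy_schwarz[OF B]) auto
  also have "\<dots> \<le> \<beta> * (D * (norm y)\<^sup>2)" by (intro mult_left_mono Bx \<beta>)
  finally have "(norm y)\<^sup>2 * (norm y)\<^sup>2 \<le> (norm y)\<^sup>2 * (D * \<beta>)"
    by (simp add: power2_eq_square mult_ac)
  hence "(norm y)\<^sup>2 \<le> D * \<beta>" if "y \<noteq> 0" by (rule mult_left_le_imp_le) (use that in simp)
  hence "(norm y)\<^sup>2 \<le> D * \<beta>" using D \<beta> by (cases "y = 0") auto
  thus ?thesis by (simp add: y_def D_def s_def \<beta>_def)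
qed

section \<open>Boundedness of the solution\<close>

text \<open>The left-hand side is the cost \<open>\<langle>C u', u'\<rangle> + \<langle>B v', v'\<rangle>\<close> plus \<open>2 Re \<langle>r - u', v\<rangle>\<close>.  The difference \<open>\<alpha> = r - u'\<close>
  solves \<open>(A - z) \<alpha> = B v'\<close>, and expanding \<open>\<langle>C (u' + \<alpha>), u' + \<alpha>\<rangle>\<close> with the help of this equation shows that the
  gap in the inequality is \<open>\<langle>B v', v'\<rangle> + \<langle>C \<alpha>, \<alpha>\<rangle>\<close>.\<close>

lemma cost_comparison:
  assumes z: "Re z = 0" and r: "r \<in> dom_op A" "A \<cdot> r - z *\<^sub>C r = u"
    and u': "u' \<in> dom_op A" and v': "v' \<in> dom_op (adj A)"
    and eq: "ham A B C \<cdot> (u', v') - z *\<^sub>C (u', v') = (u, v)"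
  shows "2 * Re (cinner r v) + Re (cinner (u', v') (- v, u)) \<le> Re (cinner (C \<cdot> r) r)"
proof -
  have e1: "A \<cdot> u' + B \<cdot> v' - z *\<^sub>C u' = u" and e2: "C \<cdot> u' - adj A \<cdot> v' - z *\<^sub>C v' = v"
    using eq by (auto simp: ham_apply scaleC_prod_def)
  have cz: "cnj z = - z" using z by (simp add: complex_eq_iff)
  define \<alpha> where "\<alpha> = r - u'"
  have \<alpha>: "\<alpha> \<in> dom_op A" unfolding \<alpha>_def using r u' linA(1) csubspace_ops(3) by blast
  have A\<alpha>: "A \<cdot> \<alpha> = B \<cdot> v' + z *\<^sub>C \<alpha>"
    using e1 r u' by (simp add: \<alpha>_def linA(5) scaleC_diff_right algebra_simps)
  have r_eq: "r = u' + \<alpha>" by (simp add: \<alpha>_def)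
  have C\<alpha>: "C \<cdot> r = C \<cdot> u' + C \<cdot> \<alpha>"
    unfolding r_eq using u' \<alpha> domC linear_op_rules(2)[OF lin(3)] by blast
  have Cu': "C \<cdot> u' = v + adj A \<cdot> v' + z *\<^sub>C v'" using e2 by (simp add: algebra_simps)
  have Bv': "B \<cdot> v' = u - A \<cdot> u' + z *\<^sub>C u'" using e1 by (simp add: algebra_simps)
  have "cinner (adj A \<cdot> v') \<alpha> = cinner v' (A \<cdot> \<alpha>)"
    using adjD'[OF \<alpha> v'] cinner_commute[of "adj A \<cdot> v'" \<alpha>] cinner_commute[of v' "A \<cdot> \<alpha>"] by simp
  hence "cinner (C \<cdot> u') \<alpha> = cinner v \<alpha> + cinner v' (B \<cdot> v')"
    unfolding Cu' A\<alpha> by (simp add: cinner_algebra cz)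
  hence C1: "Re (cinner (C \<cdot> u') \<alpha>) = Re (cinner v \<alpha>) + Re (cinner (B \<cdot> v') v')"
    using Re_cinner_commute[of v' "B \<cdot> v'"] by simp
  have C2: "Re (cinner (C \<cdot> \<alpha>) u') = Re (cinner (C \<cdot> u') \<alpha>)"
  proof -
    have "cinner (C \<cdot> \<alpha>) u' = cinner \<alpha> (C \<cdot> u')"
      using \<alpha> u' domC by (intro symmetric_op_cinner[OF C(1)]) auto
    thus ?thesis using Re_cinner_commute[of \<alpha> "C \<cdot> u'"] by simp
  qed
  have "Re (cinner (adj A \<cdot> v') u') = Re (cinner (A \<cdot> u') v')"
    using adjD'[OF u' v'] Re_cinner_commute[of "adj A \<cdot> v'" u'] by simp
  moreover have "Re (cinner (z *\<^sub>C v') u') = - Re (cinner (z *\<^sub>C u') v')"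
    using cinner_commute[of u' v'] z by (simp add: cinner_scaleC_left)
  ultimately have cost: "Re (cinner (C \<cdot> u') u') + Re (cinner (B \<cdot> v') v')
      = Re (cinner v u') + Re (cinner u v')"
    unfolding Cu' Bv' by (simp add: cinner_algebra)
  have nn: "0 \<le> Re (cinner (B \<cdot> v') v')" "0 \<le> Re (cinner (C \<cdot> \<alpha>) \<alpha>)"
    using nonneg_op_Re[OF B(2), of v'] nonneg_op_Re[OF C(2), of \<alpha>] v' \<alpha> domB domC by auto
  have "Re (cinner (C \<cdot> r) r) = Re (cinner (C \<cdot> u') u') + Re (cinner (C \<cdot> u') \<alpha>)
      + Re (cinner (C \<cdot> \<alpha>) u') + Re (cinner (C \<cdot> \<alpha>) \<alpha>)"
    unfolding C\<alpha> by (subst r_eq) (simp add: cinner_algebra)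
  also have "\<dots> \<ge> Re (cinner v u') + Re (cinner u v') + 2 * Re (cinner v \<alpha>)"
    using C1 C2 cost nn by linarith
  finally show ?thesis
    using Re_cinner_commute[of v u'] Re_cinner_commute[of u v'] Re_cinner_commute[of v r]
    by (simp add: cinner_prod_def \<alpha>_def cinner_algebra)
qed

text \<open>Integrating the comparison over the imaginary axis: with \<open>r\<close> and \<open>(u', v')\<close> taken at \<open>z = i t\<close>, the left-hand
  side has principal value integral \<open>2 \<pi> Re \<langle>u, v\<rangle>\<close>.\<close>

lemma solution_form_bound:
  assumes spec: "spectral_subspaces (ham A B C) Vp Vm" and w: "(u, v) \<in> Vp"
  shows "Re (cinner v u) \<le> cC * (1 + 2 * K) * K / (1 - p) * (norm u)\<^sup>2"
proof -
  let ?T = "ham A B C"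
  define G where "G = cC * (1 + 2 * K) * K"
  have G: "G \<ge> 0" using cC(1) K by (simp add: G_def)
  note d = spectral_subspaces_dichotomous[OF spec]
  define R where "R t = resolvent ?T (\<i> * of_real t) (u, v)" for t
  define r where "r t = resolvent A (\<i> * of_real t) u" for t
  \<comment> \<open>the vector \<open>(- v, u)\<close> is \<open>(v, u)\<close>, which produces the cost, minus \<open>2 (v, 0)\<close>, whose integral cancels that of \<open>r\<close>\<close>
  define q where "q t = 2 * Re (cinner (r t) v) + Re (cinner (R t) (- v, u))" for t
  have res: "\<i> * of_real t \<in> resolvent_set A" for t using resolvent_decayD(1)[OF decay] by simp
  have "proj_along Vp Vm (u, v) = (u, v)" "proj_along Vm Vp (u, v) = 0"
    using complementary_proj(4,5)[OF d(3)] w by blast+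
  hence limR: "((\<lambda>\<rho>. integral {-\<rho>..\<rho>} (\<lambda>t. cinner (R t) y)) \<longlongrightarrow> of_real pi * cinner (u, v) y) at_top" for y
    using spectral_subspaces_integral[OF spec, of "(u, v)" y] by (simp add: R_def)
  have limr: "((\<lambda>\<rho>. integral {-\<rho>..\<rho>} (\<lambda>t. cinner (r t) v)) \<longlongrightarrow> of_real pi * cinner u v) at_top"
    unfolding r_def by (rule resolvent_integral_limit[OF A decay])
  have cont_r: "continuous_on X r" for X unfolding r_def
    by (rule continuous_on_compose2[OF resolvent_continuous[OF lin(1), of "range (\<lambda>t. \<i> * of_real t)"]])
       (use res in \<open>auto intro!: continuous_intros\<close>)
  have intr: "(\<lambda>t. cinner (r t) v) integrable_on {-\<rho>..\<rho>}" for \<rho>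
    by (intro integrable_continuous_interval
        bounded_linear.continuous_on[OF bounded_linear_cinner_left] cont_r)
  have intR: "(\<lambda>t. cinner (R t) y) integrable_on {-\<rho>..\<rho>}" for \<rho> y unfolding R_def
    by (intro integrable_continuous_interval
        bounded_linear.continuous_on[OF bounded_linear_cinner_left] spectral_subspaces_continuous[OF spec])
  have q_int: "(q has_integral (2 * Re (integral {-\<rho>..\<rho>} (\<lambda>t. cinner (r t) v))
      + Re (integral {-\<rho>..\<rho>} (\<lambda>t. cinner (R t) (- v, u))))) {-\<rho>..\<rho>}" for \<rho>
    unfolding q_def
    by (intro has_integral_add has_integral_mult_right has_integral_Re integrable_integral intr intR)
  have le: "2 * Re (integral {-\<rho>..\<rho>} (\<lambda>t. cinner (r t) v))
      + Re (integral {-\<rho>..\<rho>} (\<lambda>t. cinner (R t) (- v, u))) \<le> G * (norm u)\<^sup>2 * (2 / (1 - p))"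
    if "\<rho> \<ge> 0" for \<rho>
  proof -
    note w = integral_weight_bound[OF p that]
    have "2 * Re (integral {-\<rho>..\<rho>} (\<lambda>t. cinner (r t) v))
        + Re (integral {-\<rho>..\<rho>} (\<lambda>t. cinner (R t) (- v, u)))
        \<le> G * (norm u)\<^sup>2 * integral {-\<rho>..\<rho>} (\<lambda>t. (1 + \<bar>t\<bar>) powr (p - 2))"
    proof (rule has_integral_le[OF q_int has_integral_mult_right[OF integrable_integral[OF w(1)]]])
      fix t
      note rt = resolvent_props[OF res[of t], of u] and Rt = resolvent_props[OF d(4)[of t], of "(u, v)"]
      obtain u' v' where uv: "R t = (u', v')" by (cases "R t")
      have "q t \<le> Re (cinner (C \<cdot> r t) (r t))"
        unfolding q_def uv
        by (rule cost_comparison[where z = "\<i> * of_real t"])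
           (use rt(1,2) Rt(1,2) uv in \<open>auto simp: R_def r_def dom_ham\<close>)
      also have "\<dots> \<le> G * (1 + cmod (\<i> * of_real t)) powr (p - 2)
          * (norm (A \<cdot> r t - (\<i> * of_real t) *\<^sub>C r t))\<^sup>2"
        unfolding G_def using rt(1) by (intro C_resolvent_form) (auto simp: r_def)
      also have "\<dots> = G * (norm u)\<^sup>2 * (1 + \<bar>t\<bar>) powr (p - 2)"
        using rt(2) by (simp add: r_def norm_mult)
      finally show "q t \<le> G * (norm u)\<^sup>2 * (1 + \<bar>t\<bar>) powr (p - 2)" .
    qed
    also have "\<dots> \<le> G * (norm u)\<^sup>2 * (2 / (1 - p))"
      using G w(2) by (intro mult_left_mono) auto
    finally show ?thesis .
  qed
  have "eventually (\<lambda>\<rho>. 2 * Re (integral {-\<rho>..\<rho>} (\<lambda>t. cinner (r t) v))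
      + Re (integral {-\<rho>..\<rho>} (\<lambda>t. cinner (R t) (- v, u))) \<le> G * (norm u)\<^sup>2 * (2 / (1 - p))) at_top"
    by (rule eventually_mono[OF eventually_ge_at_top[of 0] le])
  moreover have "((\<lambda>\<rho>. 2 * Re (integral {-\<rho>..\<rho>} (\<lambda>t. cinner (r t) v))
      + Re (integral {-\<rho>..\<rho>} (\<lambda>t. cinner (R t) (- v, u))))
      \<longlongrightarrow> 2 * Re (of_real pi * cinner u v) + Re (of_real pi * cinner (u, v) (- v, u))) at_top"
    by (intro tendsto_intros limr limR)
  ultimately have "2 * Re (of_real pi * cinner u v) + Re (of_real pi * cinner (u, v) (- v, u))
      \<le> G * (norm u)\<^sup>2 * (2 / (1 - p))"
    by (intro tendsto_upperbound) auto
  hence "2 * (pi * Re (cinner v u)) \<le> 2 * (G / (1 - p) * (norm u)\<^sup>2)"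
    using Re_cinner_commute[of u v] by (simp add: cinner_prod_def algebra_simps)
  moreover have "1 * Re (cinner v u) \<le> pi * Re (cinner v u)" if "Re (cinner v u) \<ge> 0"
    using that pi_gt3 by (intro mult_right_mono) auto
  moreover have "0 \<le> G / (1 - p) * (norm u)\<^sup>2" using G p by simp
  ultimately show ?thesis unfolding G_def[symmetric] by linarith
qed

section \<open>The domain of the Riccati equation\<close>

text \<open>On vectors where the Riccati equation makes sense, it bounds \<open>A\<^sup>* X u\<close> by \<open>A u\<close>, since the term
  \<open>X B X u\<close> can be absorbed.  Thus \<open>B X\<close> inherits from \<open>B\<close> that it is subordinate with exponent below
  one, now with respect to \<open>A\<close>.\<close>

lemma riccati_relative_bound:
  assumes X: "bounded_clinear X" and D: "D \<subseteq> dom_op A"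
    and ric: "\<And>u. u \<in> D \<Longrightarrow> X u \<in> dom_op (adj A)"
      "\<And>u. u \<in> D \<Longrightarrow> adj A \<cdot> X u + X (A \<cdot> u) + X (B \<cdot> X u) - C \<cdot> u = 0"
    and \<epsilon>: "\<epsilon> > 0"
  shows "\<exists>\<mu>>0. \<forall>u\<in>D. norm (B \<cdot> X u) \<le> \<epsilon> * norm (A \<cdot> u + of_real \<mu> *\<^sub>C u)"
proof -
  obtain N where N: "N > 0" "\<And>x. norm (X x) \<le> N * norm x" using bounded_clinear_bound[OF X] by blast
  \<comment> \<open>the choice of \<open>s0\<close> makes the norm of \<open>X B X u\<close> at most half that of \<open>A\<^sup>* X u\<close>, up to multiples of \<open>u\<close>\<close>
  obtain s0 where s0: "s0 > 1" "(cB * N) * s0 powr (p - 1) \<le> 1 / 2" using powr_small[OF p, of "1/2"] by auto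
  define L where "L = 2 * cC + 2 * N + s0 * N"
  have L: "L \<ge> 0" using cC(1) N(1) s0(1) by (simp add: L_def)
  have adj_bound: "norm (adj A \<cdot> X u) \<le> L * (norm u + norm (A \<cdot> u))" if u: "u \<in> D" for u
  proof -
    define a where "a = norm (adj A \<cdot> X u)"
    have uA: "u \<in> dom_op A" using u D by blast
    have "norm (B \<cdot> X u) \<le> cB * s0 powr (p - 1) * (s0 * norm (X u) + a)"
      using cB(2)[of s0 "X u"] ric(1)[OF u] s0(1) by (simp add: a_def)
    also have "\<dots> \<le> cB * s0 powr (p - 1) * (s0 * (N * norm u) + a)"
      using cB(1) s0(1) N(2)[of u] by (intro mult_left_mono add_mono) auto
    finally have "N * norm (B \<cdot> X u) \<le> N * (cB * s0 powr (p - 1) * (s0 * (N * norm u) + a))"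
      using N(1) by (intro mult_left_mono) auto
    also have "\<dots> = (cB * N) * s0 powr (p - 1) * (s0 * (N * norm u) + a)" by simp
    also have "\<dots> \<le> 1 / 2 * (s0 * (N * norm u) + a)"
      using s0 N(1) by (intro mult_right_mono) (auto simp: a_def)
    finally have BX: "2 * (N * norm (B \<cdot> X u)) \<le> s0 * (N * norm u) + a" by (simp add: field_simps)
    have "adj A \<cdot> X u = C \<cdot> u - X (A \<cdot> u) - X (B \<cdot> X u)"
      using ric(2)[OF u] by (simp add: algebra_simps)
    hence a: "a \<le> norm (C \<cdot> u) + norm (X (A \<cdot> u)) + norm (X (B \<cdot> X u))"
      unfolding a_def by (simp only:) (rule order_trans[OF norm_triangle_ineq4 add_right_mono[OF norm_triangle_ineq4]])
    have Cu: "norm (C \<cdot> u) \<le> cC * (norm u + norm (A \<cdot> u))" using cC(2)[of 1 u] uA by simp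
    have "a \<le> 2 * (cC * (norm u + norm (A \<cdot> u))) + 2 * (N * norm (A \<cdot> u)) + s0 * (N * norm u)"
    proof -
      have arith: "a \<le> 2 * c' + 2 * b + e" if "a \<le> c + x + y" "c \<le> c'" "y \<le> z" "2 * z \<le> e + a" "x \<le> b"
        for c c' x y z b e :: real using that by linarith
      show ?thesis
        by (rule arith[OF a Cu N(2) BX N(2)])
    qed
    also have "\<dots> = L * (norm u + norm (A \<cdot> u)) - 2 * N * norm u - s0 * N * norm (A \<cdot> u)"
      by (simp add: L_def algebra_simps)
    also have "\<dots> \<le> L * (norm u + norm (A \<cdot> u))"
    proof -
      have "0 \<le> 2 * N * norm u" "0 \<le> s0 * N * norm (A \<cdot> u)" using N(1) s0(1) by auto
      thus ?thesis by linarith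
    qed
    finally show ?thesis by (simp add: a_def)
  qed
  define Q where "Q = N * K + L * (1 + 2 * K)"
  \<comment> \<open>the additive form is applied once more, now with \<open>s = 1 + \<mu>\<close> matching the decay of the resolvent at \<open>- \<mu>\<close>\<close>
  obtain s where s: "s > 1" "(cB * Q) * s powr (p - 1) \<le> \<epsilon>" using powr_small[OF p \<epsilon>] by blast
  have "norm (B \<cdot> X u) \<le> \<epsilon> * norm (A \<cdot> u + of_real (s - 1) *\<^sub>C u)" if u: "u \<in> D" for u
  proof -
    define g where "g = norm (A \<cdot> u + of_real (s - 1) *\<^sub>C u)"
    have g: "g \<ge> 0" by (simp add: g_def)
    have cm: "1 + cmod (- of_real (s - 1)) = s" using s(1) by (simp del: of_real_diff)
    have uA: "u \<in> dom_op A" and z: "Re (- of_real (s - 1)) \<le> 0" using u D s(1) by auto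
    note est = half_plane_estimate[OF uA z, unfolded cm scaleC_minus_left diff_minus_eq_add,
        folded g_def]
    have "s * norm (X u) \<le> s * (N * (K / s * g))"
      using s(1) N(1) est(1) N(2)[of u] by (intro mult_left_mono order_trans[OF N(2)]) auto
    hence 1: "s * norm (X u) \<le> N * K * g" using s(1) by simp
    have "K / s * g \<le> K * g" using K s(1) g by (intro mult_right_mono) (auto simp: divide_le_eq)
    hence "norm u + norm (A \<cdot> u) \<le> (1 + 2 * K) * g" using est by (simp add: algebra_simps)
    hence "norm (adj A \<cdot> X u) \<le> L * ((1 + 2 * K) * g)"
      by (intro order_trans[OF adj_bound[OF u]] mult_left_mono L)
    hence "s * norm (X u) + norm (adj A \<cdot> X u) \<le> Q * g" using 1 by (simp add: Q_def algebra_simps)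
    hence "cB * s powr (p - 1) * (s * norm (X u) + norm (adj A \<cdot> X u)) \<le> cB * s powr (p - 1) * (Q * g)"
      using cB(1) by (intro mult_left_mono) auto
    moreover have "norm (B \<cdot> X u) \<le> cB * s powr (p - 1) * (s * norm (X u) + norm (adj A \<cdot> X u))"
      using s(1) by (intro cB(2) ric(1) u) auto
    moreover have "cB * s powr (p - 1) * (Q * g) \<le> \<epsilon> * g"
      using mult_right_mono[OF s(2) g] by (simp add: mult_ac)
    ultimately show ?thesis unfolding g_def by linarith
  qed
  thus ?thesis using s(1) by (intro exI[of _ "s - 1"]) auto
qed

text \<open>The part of the Hamiltonian in its invariant graph is \<open>A + B X\<close>, whose domain \<open>D\<close> consists of the
  vectors \<open>u\<close> in the domain of \<open>A\<close> with \<open>X u\<close> in that of the adjoint, and \<open>A + B X + \<mu>\<close> is onto.  By the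
  relative bound, so is \<open>A + \<mu>\<close> restricted to \<open>D\<close>; as \<open>A + \<mu>\<close> is injective, \<open>D\<close> is all of the domain of \<open>A\<close>.\<close>

lemma invariant_graph_riccati:
  assumes X: "bounded_clinear X" and spec: "spectral_subspaces (ham A B C) (range (\<lambda>u. (u, X u))) Vm"
  shows "riccati_solution A B C X"
proof -
  let ?T = "ham A B C" and ?V = "range (\<lambda>u. (u, X u))"
  note d = spectral_subspaces_dichotomous[OF spec] and Xlin = bounded_clinear_rules[OF X]
  define D where "D = {u \<in> dom_op A. X u \<in> dom_op (adj A)}"
  have ric: "adj A \<cdot> X u + X (A \<cdot> u) + X (B \<cdot> X u) - C \<cdot> u = 0" if "u \<in> D" for u
  proof -
    have "?T \<cdot> (u, X u) \<in> ?V" using that by (intro d(5)) (auto simp: dom_ham D_def)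
    hence "C \<cdot> u - adj A \<cdot> X u = X (A \<cdot> u + B \<cdot> X u)" by (auto simp: ham_apply)
    thus ?thesis by (simp add: Xlin algebra_simps)
  qed
  \<comment> \<open>a bound by a third of \<open>A + \<mu>\<close> is a bound by half of \<open>A + B X + \<mu>\<close>, the operator known to be onto\<close>
  have "\<exists>\<mu>>0. \<forall>u\<in>D. norm (B \<cdot> X u) \<le> 1 / 3 * norm (A \<cdot> u + of_real \<mu> *\<^sub>C u)"
    by (rule riccati_relative_bound[OF X _ _ ric]) (auto simp: D_def)
  then obtain \<mu> where \<mu>: "\<mu> > 0"
    "\<And>u. u \<in> D \<Longrightarrow> norm (B \<cdot> X u) \<le> 1 / 3 * norm (A \<cdot> u + of_real \<mu> *\<^sub>C u)" by blast
  define S where "S u = A \<cdot> u + of_real \<mu> *\<^sub>C u + B \<cdot> X u" for u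
  have onto: "\<exists>u\<in>D. S u = f" for f
  proof -
    let ?g = "\<lambda>w. ?T \<cdot> w - (- of_real \<mu>) *\<^sub>C w"
    have "- of_real \<mu> \<in> resolvent_set_in ?V (restrict_op ?T ?V)" using \<mu>(1) by (intro d(6)) simp
    hence "bij_betw ?g (dom_op ?T \<inter> ?V) ?V"
      unfolding resolvent_set_in_def restrict_op_def by simp
    hence "(f, X f) \<in> ?g ` (dom_op ?T \<inter> ?V)" unfolding bij_betw_def by blast
    then obtain u where "(u, X u) \<in> dom_op ?T" "(f, X f) = ?g (u, X u)" by blast
    hence "u \<in> D \<and> S u = f" by (simp add: D_def S_def dom_ham ham_apply scaleC_prod_def)
    thus ?thesis by blast
  qed
  have diffD: "u - v \<in> D" if "u \<in> D" "v \<in> D" for u v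
    using that csubspace_ops(3)[OF linA(1)] csubspace_ops(3)[OF lin_adj(1)] by (auto simp: D_def Xlin)
  have BX_diff: "B \<cdot> X (u - v) = B \<cdot> X u - B \<cdot> X v" if "u \<in> D" "v \<in> D" for u v
    using that domB by (simp add: Xlin D_def linB(5) subset_iff)
  have S_diff: "S (u - v) = S u - S v" if "u \<in> D" "v \<in> D" for u v
    using that BX_diff[OF that] by (simp add: S_def linA(5) scaleC_diff_right D_def)
  have small: "norm (- (B \<cdot> X u)) \<le> 1 / 2 * norm (S u)" if "u \<in> D" for u
  proof -
    have "A \<cdot> u + of_real \<mu> *\<^sub>C u = S u - B \<cdot> X u" by (simp add: S_def)
    hence "norm (A \<cdot> u + of_real \<mu> *\<^sub>C u) \<le> norm (S u) + norm (B \<cdot> X u)"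
      by (simp only: norm_triangle_ineq4)
    thus ?thesis using \<mu>(2)[OF that] by simp
  qed
  have onto_A: "\<exists>u\<in>D. S u + - (B \<cdot> X u) = g" for g
    by (rule onto_perturbation[where q = "1/2", OF diffD S_diff _ small _ _ onto]) (auto simp: BX_diff)
  have "u \<in> D" if u: "u \<in> dom_op A" for u
  proof -
    obtain u' where u': "u' \<in> D" "S u' + - (B \<cdot> X u') = A \<cdot> u + of_real \<mu> *\<^sub>C u" using onto_A by blast
    have z: "- of_real \<mu> \<in> resolvent_set A" using \<mu>(1) by (intro resolvent_decayD(1)[OF decay]) simp
    have "resolvent A (- of_real \<mu>) (A \<cdot> u + of_real \<mu> *\<^sub>C u) = u'"
      by (rule resolvent_props(3)[OF z]) (use u' in \<open>auto simp: S_def D_def\<close>)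
    moreover have "resolvent A (- of_real \<mu>) (A \<cdot> u + of_real \<mu> *\<^sub>C u) = u"
      by (rule resolvent_props(3)[OF z u]) simp
    ultimately have "u' = u" by (rule trans[OF sym])
    thus ?thesis using u' by simp
  qed
  thus ?thesis using ric by (auto simp: riccati_solution_def D_def)
qed

section \<open>Uniqueness\<close>

text \<open>Quadratic forms with real values are Hermitian, by polarisation.\<close>

lemma nonneg_imp_symmetric:
  fixes X :: "'b::complex_inner \<Rightarrow> 'b"
  assumes X: "bounded_clinear X" and nn: "nonneg_op (Op UNIV X)"
  shows "cinner (X x) y = cinner x (X y)"
proof -
  note Xlin = bounded_clinear_rules[OF X]
  have im: "Im (cinner (X x) x) = 0" for x using nn by (auto simp: nonneg_op_def complex_nonneg_Reals_iff)
  have "Im (cinner (X (x + y)) (x + y)) = 0" by (rule im)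
  hence "Im (cinner (X x) y) + Im (cinner (X y) x) = 0"
    using im[of x] im[of y] by (simp add: Xlin cinner_algebra)
  moreover have "Im (cinner (X (\<i> *\<^sub>C x + y)) (\<i> *\<^sub>C x + y)) = 0" by (rule im)
  hence "Re (cinner (X x) y) - Re (cinner (X y) x) = 0"
    using im[of x] im[of y] by (simp add: Xlin cinner_algebra)
  ultimately have "cinner (X x) y = cnj (cinner (X y) x)" by (simp add: complex_eq_iff)
  thus ?thesis using cinner_commute[of x "X y"] by simp
qed

text \<open>Let \<open>f = (A + B X - z) u\<close>.  The Riccati equation turns \<open>2 Re \<langle>f, X u\<rangle>\<close> into
  \<open>\<langle>C u, u\<rangle> + \<langle>B X u, X u\<rangle> - 2 Re z \<langle>X u, u\<rangle>\<close>, a sum of nonnegative terms, so \<open>\<langle>B X u, X u\<rangle>\<close> is small if \<open>f\<close> is.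
  Then \<open>u = (A - z)\<^sup>-\<^sup>1 f - (A - z)\<^sup>-\<^sup>1 B X u\<close> is small as well.\<close>

lemma closed_loop_lower_bound:
  assumes X: "bounded_clinear X" "nonneg_op (Op UNIV X)" and ric: "riccati_solution A B C X"
    and N: "N > 0" "\<And>x. norm (X x) \<le> N * norm x" and u: "u \<in> dom_op A" and z: "Re z \<le> 0"
  shows "norm u \<le> (2 * K + 2 * (cB * (1 + 2 * K) * K) * N) / (1 + cmod z)
    * norm (A \<cdot> u + B \<cdot> X u - z *\<^sub>C u)"
proof -
  define f v s D where "f = A \<cdot> u + B \<cdot> X u - z *\<^sub>C u" and "v = X u" and "s = 1 + cmod z"
    and "D = cB * (1 + 2 * K) * K"
  have s: "s \<ge> 1" by (simp add: s_def)
  have D: "D \<ge> 0" using cB(1) K by (simp add: D_def)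
  note sym = nonneg_imp_symmetric[OF X] and d = resolvent_decayD[OF decay z]
  have v: "v \<in> dom_op (adj A)" and eq: "adj A \<cdot> v + X (A \<cdot> u) + X (B \<cdot> v) - C \<cdot> u = 0"
    using ric u by (auto simp: riccati_solution_def v_def)
  define \<beta> where "\<beta> = Re (cinner (B \<cdot> v) v)"
  have \<beta>: "\<beta> \<ge> 0" using nonneg_op_Re[OF B(2)] v domB by (auto simp: \<beta>_def)
  have Cu: "Re (cinner (C \<cdot> u) u) \<ge> 0" using nonneg_op_Re[OF C(2)] u domC by auto
  have Xu: "Re (cinner u v) \<ge> 0"
    using nonneg_op_Re[OF X(2), of u] Re_cinner_commute[of u] by (simp add: v_def)
  have "C \<cdot> u = adj A \<cdot> v + X (A \<cdot> u) + X (B \<cdot> v)" using eq by simp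
  hence "Re (cinner (C \<cdot> u) u) = Re (cinner (adj A \<cdot> v) u) + Re (cinner (X (A \<cdot> u)) u) + Re (cinner (X (B \<cdot> v)) u)"
    by (simp only: cinner_add_left plus_complex.sel)
  also have "\<dots> = 2 * Re (cinner (A \<cdot> u) v) + \<beta>"
    using adjD'[OF u v] Re_cinner_commute[of u "adj A \<cdot> v"] by (simp add: sym \<beta>_def flip: v_def)
  finally have ric_form: "Re (cinner (C \<cdot> u) u) = 2 * Re (cinner (A \<cdot> u) v) + \<beta>" .
  have im: "Im (cinner u v) = 0"
    using X(2) cinner_commute[of u v] by (auto simp: nonneg_op_def complex_nonneg_Reals_iff v_def)
  have "Re (cinner f v) = Re (cinner (A \<cdot> u) v) + \<beta> - Re z * Re (cinner u v)"
    by (simp add: f_def \<beta>_def cinner_algebra im flip: v_def)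
  moreover have "Re z * Re (cinner u v) \<le> 0" using z Xu by (rule mult_nonpos_nonneg)
  ultimately have "\<beta> \<le> 2 * Re (cinner f v)" using ric_form Cu by linarith
  also have "\<dots> \<le> 2 * (norm f * (N * norm u))"
    using N(2)[of u] order_trans[OF Re_cinner_le[of f v] mult_left_mono] by (simp add: v_def)
  finally have \<beta>_le: "\<beta> \<le> 2 * (norm f * (N * norm u))" .
  define y where "y = norm (resolvent A z (B \<cdot> v))"
  have "y\<^sup>2 \<le> D / s * \<beta>" using resolvent_B_form[OF v z] by (simp add: y_def D_def s_def \<beta>_def)
  also have "\<dots> \<le> D / s * (2 * (norm f * (N * norm u)))" using D s \<beta>_le by (intro mult_left_mono) auto
  \<comment> \<open>the inequality of arithmetic and geometric means leaves half of the norm of \<open>u\<close>, to be absorbed on the left\<close>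
  also have "\<dots> = 2 * (D * N / s * norm f) * norm u" by simp
  also have "\<dots> \<le> (D * N / s * norm f + norm u / 2)\<^sup>2"
    using zero_le_power2[of "D * N / s * norm f - norm u / 2"]
    by (simp add: power2_sum power2_diff)
  finally have y: "y \<le> D * N / s * norm f + norm u / 2"
    by (rule power2_le_imp_le) (use D N(1) s in auto)
  have "A \<cdot> u - z *\<^sub>C u = f - B \<cdot> v" by (simp add: f_def v_def)
  hence "u = resolvent A z (f - B \<cdot> v)" using resolvent_props(3)[OF d(1) u] by simp
  also have "\<dots> = resolvent A z f - resolvent A z (B \<cdot> v)" by (rule resolvent_linear(3)[OF lin(1) d(1)])
  finally have "norm u \<le> norm (resolvent A z f) + y" unfolding y_def by (metis norm_triangle_ineq4)
  also have "\<dots> \<le> K / s * norm f + (D * N / s * norm f + norm u / 2)"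
    using d(2)[of f] y by (simp add: s_def)
  finally have "norm u \<le> 2 * (K / s * norm f) + 2 * (D * N / s * norm f)" by simp
  also have "\<dots> = (2 * K + 2 * D * N) / s * norm f" by (simp add: add_divide_distrib algebra_simps)
  finally show ?thesis by (simp add: f_def s_def D_def)
qed

text \<open>Surjectivity holds far out on the negative axis and propagates through the half-plane in
  steps whose length is controlled by the uniform lower bound.\<close>

lemma closed_loop_resolvent_decay:
  assumes X: "bounded_clinear X" "nonneg_op (Op UNIV X)" and ric: "riccati_solution A B C X"
  defines "F \<equiv> Op (dom_op A) (\<lambda>u. A \<cdot> u + B \<cdot> X u)"
  shows "densely_defined F" "\<exists>K'. resolvent_decay F K'"
proof -
  note Xlin = bounded_clinear_rules[OF X(1)]
  have XB: "X u \<in> dom_op B" if "u \<in> dom_op A" for u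
    using that ric domB by (auto simp: riccati_solution_def)
  have linF: "linear_op F"
    using linA(1) XB by (auto simp: linear_op_def F_def linA(2,3) Xlin linB(2,3) scaleC_add_right
        algebra_simps)
  thus "densely_defined F" using A by (simp add: densely_defined_def F_def)
  obtain N where N: "N > 0" "\<And>x. norm (X x) \<le> N * norm x" using bounded_clinear_bound[OF X(1)] by blast
  define K' where "K' = 2 * K + 2 * (cB * (1 + 2 * K) * K) * N"
  have K': "K' > 0" using K cB(1) N(1) by (auto simp: K'_def intro!: add_pos_nonneg)
  define S where "S z u = A \<cdot> u + B \<cdot> X u - z *\<^sub>C u" for z u
  have lower: "norm u \<le> K' / (1 + cmod z) * norm (S z u)" if "u \<in> dom_op A" "Re z \<le> 0" for u z
    using closed_loop_lower_bound[OF X ric N that] by (simp add: K'_def S_def)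
  have lower': "norm u \<le> K' * norm (S z u)" if "u \<in> dom_op A" "Re z \<le> 0" for u z
  proof -
    have "K' / (1 + cmod z) \<le> K'" using K' by (simp add: divide_le_eq add_pos_nonneg)
    thus ?thesis using order_trans[OF lower[OF that] mult_right_mono] by simp
  qed
  have diff: "u - v \<in> dom_op A" if "u \<in> dom_op A" "v \<in> dom_op A" for u v
    using that csubspace_ops(3)[OF linA(1)] by blast
  have BX_diff: "B \<cdot> X (u - v) = B \<cdot> X u - B \<cdot> X v" if "u \<in> dom_op A" "v \<in> dom_op A" for u v
    using that XB by (simp add: Xlin linB(5))
  have S_diff: "S z (u - v) = S z u - S z v" if "u \<in> dom_op A" "v \<in> dom_op A" for z u v
    using that by (simp add: S_def BX_diff linA(5) scaleC_diff_right)
  have "\<exists>\<mu>>0. \<forall>u\<in>dom_op A. norm (B \<cdot> X u) \<le> 1 / 2 * norm (A \<cdot> u + of_real \<mu> *\<^sub>C u)"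
    by (rule riccati_relative_bound[OF X(1) subset_refl])
       (use ric in \<open>auto simp: riccati_solution_def\<close>)
  then obtain \<mu> where \<mu>: "\<mu> > 0" "\<And>u. u \<in> dom_op A \<Longrightarrow>
      norm (B \<cdot> X u) \<le> 1 / 2 * norm (A \<cdot> u + of_real \<mu> *\<^sub>C u)" by blast
  have start: "\<exists>u\<in>dom_op A. S (- of_real \<mu>) u = f" for f
  proof -
    have onto: "\<exists>u\<in>dom_op A. A \<cdot> u + of_real \<mu> *\<^sub>C u = f" for f
      using resolvent_props(1,2)[OF resolvent_decayD(1)[OF decay], of "- of_real \<mu>" f] \<mu>(1) by auto
    have "\<exists>u\<in>dom_op A. (A \<cdot> u + of_real \<mu> *\<^sub>C u) + B \<cdot> X u = f"
      by (rule onto_perturbation[where q = "1/2", OF diff _ BX_diff \<mu>(2) _ _ onto])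
         (auto simp: linA(5) scaleC_diff_right)
    thus ?thesis by (simp add: S_def algebra_simps)
  qed
  have step: "\<exists>u\<in>dom_op A. S z' u = f"
    if onto: "\<And>f. \<exists>u\<in>dom_op A. S z u = f" and z: "Re z \<le> 0" and near: "cmod (z - z') * K' \<le> 1 / 2" for z z' f
  proof -
    have "\<exists>u\<in>dom_op A. S z u + (z - z') *\<^sub>C u = f"
    proof (rule onto_perturbation[where q = "1/2", OF diff S_diff _ _ _ _ onto])
      fix u assume u: "u \<in> dom_op A"
      have "norm ((z - z') *\<^sub>C u) \<le> cmod (z - z') * (K' * norm (S z u))"
        unfolding norm_scaleC by (intro mult_left_mono lower' u z) auto
      also have "\<dots> \<le> 1 / 2 * norm (S z u)" using mult_right_mono[OF near, of "norm (S z u)"] by simp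
      finally show "norm ((z - z') *\<^sub>C u) \<le> 1 / 2 * norm (S z u)" .
    qed (auto simp: scaleC_diff_right)
    thus ?thesis by (simp add: S_def scaleC_diff_left algebra_simps)
  qed
  have onto: "\<exists>u\<in>dom_op A. S z u = f" if z: "Re z \<le> 0" for z f
  proof -
    \<comment> \<open>walk from \<open>- \<mu>\<close> to \<open>z\<close> in \<open>n\<close> equal steps, each of length at most \<open>1 / (2 K')\<close>\<close>
    define d where "d = z + of_real \<mu>"
    obtain n where n: "cmod d * K' * 2 < real n" using reals_Archimedean2 by blast
    have "0 \<le> cmod d * K' * 2" using K' by simp
    hence n0: "real n > 0" using n by linarith
    define \<zeta> where "\<zeta> k = - of_real \<mu> + of_real (real k / real n) * d" for k
    have Re\<zeta>: "Re (\<zeta> k) \<le> 0" if "k \<le> n" for k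
    proof -
      have "Re (\<zeta> k) = (1 - real k / real n) * (- \<mu>) + real k / real n * Re z"
        by (simp add: \<zeta>_def d_def algebra_simps add_divide_distrib)
      moreover have "real k / real n \<le> 1" using that n0 by simp
      hence "(1 - real k / real n) * (- \<mu>) \<le> 0"
        using \<mu>(1) by (intro mult_nonneg_nonpos) auto
      moreover have "real k / real n * Re z \<le> 0" using z by (intro mult_nonneg_nonpos) auto
      ultimately show ?thesis by linarith
    qed
    have "\<forall>f. \<exists>u\<in>dom_op A. S (\<zeta> k) u = f" if "k \<le> n" for k
      using that
    proof (induction k)
      case 0
      thus ?case using start by (simp add: \<zeta>_def)
    next
      case (Suc k)
      have "\<zeta> k - \<zeta> (Suc k) = - of_real (1 / real n) * d"
        by (simp add: \<zeta>_def add_divide_distrib algebra_simps)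
      hence "cmod (\<zeta> k - \<zeta> (Suc k)) * K' = cmod d * K' / real n"
        by (simp add: norm_mult norm_divide)
      also have "\<dots> \<le> 1 / 2" using n n0 by (simp add: divide_le_eq)
      finally have near: "cmod (\<zeta> k - \<zeta> (Suc k)) * K' \<le> 1 / 2" .
      have "\<exists>u\<in>dom_op A. S (\<zeta> (Suc k)) u = f" for f
        by (rule step[of "\<zeta> k"]) (use Suc Re\<zeta>[of k] near in auto)
      thus ?case by blast
    qed
    from this[of n] show ?thesis using n0 by (simp add: \<zeta>_def d_def)
  qed
  have "resolvent_decay F K'" unfolding resolvent_decay_def
  proof (intro allI impI conjI)
    fix z x assume z: "Re z \<le> 0"
    have S_F: "F \<cdot> u - z *\<^sub>C u = S z u" for u by (simp add: F_def S_def)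
    show res: "z \<in> resolvent_set F"
      by (rule resolvent_setI[OF linF, of _ K']) (unfold S_F, use onto lower' z in \<open>auto simp: F_def\<close>)
    show "norm (resolvent F z x) \<le> K' / (1 + cmod z) * norm x"
      using lower[OF _ z, of "resolvent F z x"] resolvent_props(1,2)[OF res, of x, unfolded S_F]
      by (simp add: F_def)
  qed
  thus "\<exists>K'. resolvent_decay F K'" by blast
qed

text \<open>By invariance, \<open>(T - z)\<^sup>-\<^sup>1\<close> acts on the graph of \<open>X\<close> as the resolvent of \<open>A + B X\<close>, whose principal
  value integral over the imaginary axis is \<open>\<pi>\<close> times the identity.  Hence \<open>P\<^sub>+ - P\<^sub>-\<close> is the identity there.\<close>

lemma riccati_graph_subset:
  assumes spec: "spectral_subspaces (ham A B C) Vp Vm"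
    and X: "bounded_clinear X" "nonneg_op (Op UNIV X)" and ric: "riccati_solution A B C X"
  shows "(u, X u) \<in> Vp"
proof -
  let ?T = "ham A B C" and ?w = "(u, X u)"
  define F where "F = Op (dom_op A) (\<lambda>u. A \<cdot> u + B \<cdot> X u)"
  note d = spectral_subspaces_dichotomous[OF spec] and Xlin = bounded_clinear_rules[OF X(1)]
  obtain K' where F: "densely_defined F" and decayF: "resolvent_decay F K'"
    using closed_loop_resolvent_decay[OF X ric] by (auto simp: F_def)
  define r where "r t = resolvent F (\<i> * of_real t) u" for t
  have res: "resolvent ?T (\<i> * of_real t) ?w = (r t, X (r t))" for t
  proof (rule resolvent_props(3)[OF d(4)])
    have "\<i> * of_real t \<in> resolvent_set F" by (rule resolvent_decayD(1)[OF decayF]) simp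
    from resolvent_props(1,2)[OF this, of u]
    have r: "r t \<in> dom_op A" "A \<cdot> r t + B \<cdot> X (r t) - (\<i> * of_real t) *\<^sub>C r t = u"
      by (auto simp: r_def F_def)
    have ric': "X (r t) \<in> dom_op (adj A)"
      "adj A \<cdot> X (r t) + X (A \<cdot> r t) + X (B \<cdot> X (r t)) - C \<cdot> r t = 0"
      using ric r(1) by (auto simp: riccati_solution_def)
    show "(r t, X (r t)) \<in> dom_op ?T" using r(1) ric'(1) by (simp add: dom_ham)
    have "C \<cdot> r t - adj A \<cdot> X (r t) - (\<i> * of_real t) *\<^sub>C X (r t)
        = X (A \<cdot> r t + B \<cdot> X (r t) - (\<i> * of_real t) *\<^sub>C r t)"
      using ric'(2) by (simp add: Xlin algebra_simps)
    thus "?T \<cdot> (r t, X (r t)) - (\<i> * of_real t) *\<^sub>C (r t, X (r t)) = ?w"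
      using r(2) by (simp add: ham_apply scaleC_prod_def)
  qed
  have "of_real pi * cinner (proj_along Vp Vm ?w - proj_along Vm Vp ?w) y = of_real pi * cinner ?w y" for y
  proof (rule tendsto_unique[OF trivial_limit_at_top_linorder spectral_subspaces_integral[OF spec]])
    have "cinner (a, X a) y = cinner a (fst y + X (snd y))" for a
      by (simp add: cinner_prod_def cinner_add_right nonneg_imp_symmetric[OF X])
    thus "((\<lambda>\<rho>. integral {-\<rho>..\<rho>} (\<lambda>t. cinner (resolvent ?T (\<i> * of_real t) ?w) y))
        \<longlongrightarrow> of_real pi * cinner ?w y) at_top"
      using resolvent_integral_limit[OF F decayF, of u "fst y + X (snd y)"] by (simp add: res r_def)
  qed
  hence "proj_along Vp Vm ?w - proj_along Vm Vp ?w = ?w" by (intro cinner_ext) simp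
  with complementary_proj(3)[OF d(3), of ?w]
  have "proj_along Vp Vm ?w - proj_along Vm Vp ?w = proj_along Vp Vm ?w + proj_along Vm Vp ?w" by simp
  hence "2 *\<^sub>R proj_along Vm Vp ?w = 0" by (simp add: scaleR_2 algebra_simps eq_neg_iff_add_eq_0)
  hence "proj_along Vp Vm ?w = ?w" using complementary_proj(3)[OF d(3), of ?w] by simp
  thus ?thesis using complementary_proj(1)[OF d(3), of ?w] by simp
qed

lemma stabilizing_solution:
  assumes spec: "spectral_subspaces (ham A B C) Vp Vm"
    and Xp: "symmetric_op Xp" "nonneg_op Xp" "graph Xp = Vp"
  shows "dom_op Xp = UNIV \<and> bounded_clinear (app Xp) \<and> riccati_solution A B C (app Xp) \<and>
    (\<forall>X. bounded_clinear X \<and> nonneg_op (Op UNIV X) \<and> riccati_solution A B C X \<longrightarrow> X = app Xp)"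
proof -
  have "closed (graph Xp)"
    using spectral_subspaces_dichotomous(3)[OF spec] Xp(3) by (simp add: complementary_def)
  moreover have "Re (cinner (Xp \<cdot> u) u) \<le> cC * (1 + 2 * K) * K / (1 - p) * (norm u)\<^sup>2"
    if "u \<in> dom_op Xp" for u
    using that Xp(3) by (intro solution_form_bound[OF spec]) (auto simp: graph_def)
  moreover have "cC * (1 + 2 * K) * K / (1 - p) \<ge> 0" using cC(1) K p by simp
  ultimately have bdd: "dom_op Xp = UNIV" "bounded_clinear (app Xp)"
    using bounded_form_imp_bounded[OF Xp(1,2)] by blast+
  have Vp: "Vp = range (\<lambda>u. (u, Xp \<cdot> u))" using Xp(3) bdd(1) by (simp add: graph_def)
  have "riccati_solution A B C (app Xp)"
    using spec unfolding Vp by (rule invariant_graph_riccati[OF bdd(2)])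
  moreover have "X = app Xp"
    if "bounded_clinear X" "nonneg_op (Op UNIV X)" "riccati_solution A B C X" for X
    using riccati_graph_subset[OF spec that] unfolding Vp by auto
  ultimately show ?thesis using bdd by blast
qed

end

section \<open>Reversing the sign of the diagonal\<close>

text \<open>\<open>flip\<close> is the unitary involution \<open>diag (1, - 1)\<close>.\<close>

definition flip :: "'a::complex_inner \<times> 'a \<Rightarrow> 'a \<times> 'a" where
  "flip w = (fst w, - snd w)"

lemma flip_flip [simp]: "flip (flip w) = w"
  by (simp add: flip_def)

lemma norm_flip [simp]: "norm (flip w) = norm w"
  by (simp add: flip_def norm_prod_def)

lemma flip_linear: "flip (v + w) = flip v + flip w" "flip (v - w) = flip v - flip w"
  "flip (c *\<^sub>C w) = c *\<^sub>C flip w" "flip (- w) = - flip w" "flip 0 = 0"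
  by (auto simp: flip_def scaleC_prod_def prod_eq_iff)

lemma bounded_linear_flip: "bounded_linear flip"
  by (rule bounded_linear_intro[where K = 1]) (auto simp: flip_def norm_prod_def)

lemma flip_image_iff: "w \<in> flip ` V \<longleftrightarrow> flip w \<in> V"
  by (metis flip_flip image_iff)

lemma flip_image_vimage: "flip ` V = flip -` V"
  by (auto simp: flip_image_iff)

lemma csubspace_flip: "csubspace V \<Longrightarrow> csubspace (flip ` V)"
  by (intro csubspaceI) (auto simp: flip_image_iff flip_linear csubspace_ops)

lemma complementary_flip:
  assumes "complementary V W"
  shows "complementary (flip ` W) (flip ` V)"
proof -
  have "closed (flip ` U)" if "closed U" for U :: "('a \<times> 'a) set"
    unfolding flip_image_vimage using that
    by (intro closed_vimage bounded_linear.continuous_on[OF bounded_linear_flip] continuous_on_id)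
  moreover have "flip ` W \<inter> flip ` V = {0}"
  proof -
    have "flip ` W \<inter> flip ` V = flip ` (V \<inter> W)"
      by (rule set_eqI) (simp only: flip_image_iff Int_iff conj_commute)
    thus ?thesis using assms by (simp add: complementary_def flip_linear)
  qed
  moreover have "\<exists>v\<in>flip ` W. \<exists>w\<in>flip ` V. x = v + w" for x
  proof -
    obtain v w where vw: "v \<in> V" "w \<in> W" "flip x = v + w"
      using assms unfolding complementary_def by blast
    have "x = flip w + flip v"
      using arg_cong[OF vw(3), of flip] by (simp add: flip_linear add.commute)
    moreover have "flip w \<in> flip ` W" "flip v \<in> flip ` V" using vw by auto
    ultimately show ?thesis by blast
  qed
  ultimately show ?thesis using assms csubspace_flip by (auto simp: complementary_def)
qed

text \<open>\<open>T'\<close> is \<open>- U T U\<close> for the involution \<open>U\<close>: a unitary transform, which leaves the resolvent set unchanged,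
  followed by a change of sign.\<close>

lemma resolvent_set_flip:
  assumes dom: "dom_op T' = flip ` dom_op T" and T': "\<And>w. w \<in> dom_op T \<Longrightarrow> T' \<cdot> flip w = - flip (T \<cdot> w)"
    and V: "csubspace V" and z: "z \<in> resolvent_set_in V T"
  shows "- z \<in> resolvent_set_in (flip ` V) T'"
proof -
  define g where "g = (\<lambda>w. T \<cdot> w - z *\<^sub>C w)"
  have bij: "bij_betw g (dom_op T) V"
    and M: "\<exists>M. \<forall>x\<in>dom_op T. norm x \<le> M * norm (g x)"
    using z unfolding resolvent_set_in_def g_def by auto
  have g': "T' \<cdot> flip w - (- z) *\<^sub>C flip w = - flip (g w)" if "w \<in> dom_op T" for w
    using T'[OF that] by (simp add: g_def flip_linear)
  have "bij_betw flip (flip ` dom_op T) (dom_op T)"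
    by (rule bij_betw_byWitness[where f' = flip]) auto
  moreover have "bij_betw (\<lambda>y. - flip y) V (flip ` V)"
  proof (rule bij_betw_byWitness[where f' = "\<lambda>y. - flip y"])
    show "(\<lambda>y. - flip y) ` V \<subseteq> flip ` V" "(\<lambda>y. - flip y) ` (flip ` V) \<subseteq> V"
      using csubspace_ops(5)[OF V]
      by (auto simp: flip_image_iff flip_linear simp del: split_paired_All)
  qed (simp_all add: flip_linear)
  ultimately have "bij_betw ((\<lambda>y. - flip y) \<circ> g \<circ> flip) (dom_op T') (flip ` V)"
    unfolding dom using bij_betw_trans[OF _ bij_betw_trans[OF bij]] by (simp add: comp_assoc)
  moreover have "((\<lambda>y. - flip y) \<circ> g \<circ> flip) w = T' \<cdot> w - (- z) *\<^sub>C w" if "w \<in> dom_op T'" for w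
    using g'[of "flip w"] that by (simp add: dom flip_image_iff)
  ultimately have "bij_betw (\<lambda>w. T' \<cdot> w - (- z) *\<^sub>C w) (dom_op T') (flip ` V)"
    by (subst (asm) bij_betw_cong) auto
  moreover have "\<exists>M. \<forall>w\<in>dom_op T'. norm w \<le> M * norm (T' \<cdot> w - (- z) *\<^sub>C w)"
  proof -
    obtain M where "\<And>x. x \<in> dom_op T \<Longrightarrow> norm x \<le> M * norm (g x)" using M by blast
    hence "norm (flip x) \<le> M * norm (T' \<cdot> flip x - (- z) *\<^sub>C flip x)" if "x \<in> dom_op T" for x
      using that by (simp only: g' norm_minus_cancel norm_flip)
    thus ?thesis unfolding dom by blast
  qed
  ultimately show ?thesis unfolding resolvent_set_in_def by blast
qed

text \<open>The substitution \<open>t \<mapsto> - t\<close> in the defining integral shows that \<open>P\<^sub>+ - P\<^sub>-\<close> for \<open>T'\<close> is \<open>- U (P\<^sub>+ - P\<^sub>-) U\<close>, that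
  is, the two subspaces change roles.\<close>

lemma spectral_subspaces_flip:
  assumes dom: "dom_op T' = flip ` dom_op T" and T': "\<And>w. w \<in> dom_op T \<Longrightarrow> T' \<cdot> flip w = - flip (T \<cdot> w)"
    and spec: "spectral_subspaces T Vp Vm"
  shows "spectral_subspaces T' (flip ` Vm) (flip ` Vp)"
proof -
  note d = spectral_subspaces_dichotomous[OF spec] and linT = linear_op_rules[OF d(2)]
  have dich: "dichotomous_wrt T Vp Vm" using spec by (simp add: spectral_subspaces_def)
  have T'_apply: "T' \<cdot> w = - flip (T \<cdot> flip w)" if "w \<in> dom_op T'" for w
    using T'[of "flip w"] that by (simp add: dom flip_image_iff)
  have sub: "csubspace Vp" "csubspace Vm" "csubspace (UNIV :: ('a \<times> 'a) set)"
    using d(3) by (auto simp: complementary_def csubspace_def subspace_UNIV)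
  have lin': "linear_op T'" unfolding linear_op_def
  proof (intro conjI ballI allI)
    show dom': "csubspace (dom_op T')" unfolding dom by (rule csubspace_flip[OF linT(1)])
    show "T' \<cdot> (x + y) = T' \<cdot> x + T' \<cdot> y" if "x \<in> dom_op T'" "y \<in> dom_op T'" for x y
      using that csubspace_ops(2)[OF dom' that]
      by (simp add: T'_apply flip_linear linT(2) dom flip_image_iff)
    show "T' \<cdot> (c *\<^sub>C x) = c *\<^sub>C (T' \<cdot> x)" if "x \<in> dom_op T'" for c x
      using that csubspace_ops(4)[OF dom' that]
      by (simp add: T'_apply flip_linear linT(3) dom flip_image_iff)
  qed
  have "flip ` closure (dom_op T) \<subseteq> closure (dom_op T')" unfolding dom
    by (intro image_closure_subset bounded_linear.continuous_on[OF bounded_linear_flip]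
        continuous_on_id closed_closure closure_subset)
  moreover have "closure (dom_op T) = UNIV" using d(1) by (simp add: densely_defined_def)
  ultimately have dense': "densely_defined T'"
    using lin' unfolding densely_defined_def by (auto simp: flip_image_iff subset_iff)
  have res': "- z \<in> resolvent_set T'" if "z \<in> resolvent_set T" for z
  proof -
    have "flip ` (UNIV :: ('a \<times> 'a) set) = UNIV" unfolding flip_image_vimage by (rule vimage_UNIV)
    thus ?thesis using resolvent_set_flip[OF dom T' sub(3) that] by simp
  qed
  have strip: "\<exists>h>0. {z. \<bar>Re z\<bar> < h} \<subseteq> resolvent_set T'"
  proof -
    obtain h where h: "h > 0" "{z. \<bar>Re z\<bar> < h} \<subseteq> resolvent_set T"
      using dich by (auto simp: dichotomous_wrt_def)
    have "z \<in> resolvent_set T'" if "\<bar>Re z\<bar> < h" for z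
      using res'[of "- z"] h(2) that by (auto simp: subset_iff)
    thus ?thesis using h(1) by blast
  qed
  have inv: "app T' ` (dom_op T' \<inter> flip ` V) \<subseteq> flip ` V"
    if "app T ` (dom_op T \<inter> V) \<subseteq> V" "csubspace V" for V
  proof -
    have eq: "flip ` dom_op T \<inter> flip ` V = flip ` (dom_op T \<inter> V)"
      by (rule set_eqI) (simp only: flip_image_iff Int_iff)
    show ?thesis unfolding dom eq
    proof (rule image_subsetI)
      fix x assume "x \<in> flip ` (dom_op T \<inter> V)"
      hence w: "flip x \<in> dom_op T" "flip x \<in> V" by (auto simp only: flip_image_iff Int_iff)
      hence "T \<cdot> flip x \<in> V" using that(1) by blast
      hence "- (T \<cdot> flip x) \<in> V" by (rule csubspace_ops(5)[OF that(2)])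
      moreover have "T' \<cdot> x = flip (- (T \<cdot> flip x))" using T'[OF w(1)] by (simp add: flip_linear)
      ultimately show "T' \<cdot> x \<in> flip ` V" by (simp only: imageI)
    qed
  qed
  have restr: "- z \<in> resolvent_set_in (flip ` V) (restrict_op T' (flip ` V))"
    if "z \<in> resolvent_set_in V (restrict_op T V)" "csubspace V" for V z
  proof (rule resolvent_set_flip[OF _ _ that(2,1)])
    show "dom_op (restrict_op T' (flip ` V)) = flip ` dom_op (restrict_op T V)"
      unfolding restrict_op_def operator.sel dom
      by (rule set_eqI) (simp only: flip_image_iff Int_iff)
  qed (simp add: restrict_op_def T')
  have "spectrum_in (flip ` Vm) (restrict_op T' (flip ` Vm)) \<subseteq> {z. Re z > 0}"
  proof
    fix z assume "z \<in> spectrum_in (flip ` Vm) (restrict_op T' (flip ` Vm))"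
    hence "- z \<in> spectrum_in Vm (restrict_op T Vm)"
      using restr[of "- z" Vm] sub(2) by (auto simp: spectrum_in_def)
    thus "z \<in> {z. Re z > 0}" using dich by (auto simp: dichotomous_wrt_def)
  qed
  moreover have "spectrum_in (flip ` Vp) (restrict_op T' (flip ` Vp)) \<subseteq> {z. Re z < 0}"
  proof
    fix z assume "z \<in> spectrum_in (flip ` Vp) (restrict_op T' (flip ` Vp))"
    hence "- z \<in> spectrum_in Vp (restrict_op T Vp)"
      using restr[of "- z" Vp] sub(1) by (auto simp: spectrum_in_def)
    thus "z \<in> {z. Re z < 0}" using dich by (auto simp: dichotomous_wrt_def)
  qed
  moreover have "app T ` (dom_op T \<inter> Vp) \<subseteq> Vp" "app T ` (dom_op T \<inter> Vm) \<subseteq> Vm"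
    using dich by (auto simp: dichotomous_wrt_def)
  ultimately have dich': "dichotomous_wrt T' (flip ` Vm) (flip ` Vp)"
    unfolding dichotomous_wrt_def
    using dense' complementary_flip[OF d(3)] strip inv sub by blast
  have proj: "proj_along (flip ` Vm) (flip ` Vp) x - proj_along (flip ` Vp) (flip ` Vm) x
      = - flip (proj_along Vp Vm (flip x) - proj_along Vm Vp (flip x))" for x
  proof -
    let ?p = "proj_along Vp Vm (flip x)" and ?m = "proj_along Vm Vp (flip x)"
    have mem: "flip ?p \<in> flip ` Vp" "flip ?m \<in> flip ` Vm"
      using complementary_proj(1,2)[OF d(3)] by auto
    have x: "x = flip ?m + flip ?p"
      using arg_cong[OF complementary_proj(3)[OF d(3), of "flip x"], of flip]
      by (simp add: flip_linear add.commute)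
    have "csubspace (flip ` Vm)" "csubspace (flip ` Vp)"
      "flip ` Vm \<inter> flip ` Vp = {0}" "flip ` Vp \<inter> flip ` Vm = {0}"
      using complementary_flip[OF d(3)] by (auto simp: complementary_def)
    hence "proj_along (flip ` Vm) (flip ` Vp) (flip ?m + flip ?p) = flip ?m"
      "proj_along (flip ` Vp) (flip ` Vm) (flip ?p + flip ?m) = flip ?p"
      using mem by (auto intro: proj_along_eq)
    hence "proj_along (flip ` Vm) (flip ` Vp) x = flip ?m" "proj_along (flip ` Vp) (flip ` Vm) x = flip ?p"
      unfolding x[symmetric] add.commute[of "flip ?p"] by auto
    thus ?thesis by (simp add: flip_linear)
  qed
  have "((\<lambda>\<rho>. (1 / (of_real pi * \<i>)) *\<^sub>C
        integral {-\<rho>..\<rho>} (\<lambda>t. \<i> *\<^sub>C resolvent T' (\<i> * of_real t) x))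
      \<longlongrightarrow> - flip (proj_along Vp Vm (flip x) - proj_along Vm Vp (flip x))) at_top" for x
  proof -
    define h where "h t = \<i> *\<^sub>C resolvent T (\<i> * of_real t) (flip x)" for t
    have integrand: "\<i> *\<^sub>C resolvent T' (\<i> * of_real t) x = - flip (h (- t))" for t
    proof -
      have "resolvent T' (\<i> * of_real t) x = - flip (resolvent T (\<i> * of_real (- t)) (flip x))"
      proof (rule resolvent_props(3))
        let ?y = "resolvent T (\<i> * of_real (- t)) (flip x)"
        note y = resolvent_props(1,2)[OF d(4), of "- t" "flip x"]
        show "\<i> * of_real t \<in> resolvent_set T'" using res'[OF d(4)[of "- t"]] by simp
        show dom_y: "- flip ?y \<in> dom_op T'"
          using y(1) csubspace_ops(5)[OF linT(1)] by (simp add: dom flip_image_iff flip_linear)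
        have "T' \<cdot> (- flip ?y) = flip (T \<cdot> ?y)"
          unfolding T'_apply[OF dom_y] using y(1) by (simp add: flip_linear linT(4))
        hence "T' \<cdot> (- flip ?y) - (\<i> * of_real t) *\<^sub>C (- flip ?y)
            = flip (T \<cdot> ?y - (\<i> * of_real (- t)) *\<^sub>C ?y)" by (simp add: flip_linear)
        also have "\<dots> = x" by (simp only: y(2) flip_flip)
        finally show "T' \<cdot> (- flip ?y) - (\<i> * of_real t) *\<^sub>C (- flip ?y) = x" .
      qed
      thus ?thesis by (simp add: h_def flip_linear)
    qed
    have "integral {-\<rho>..\<rho>} (\<lambda>t. \<i> *\<^sub>C resolvent T' (\<i> * of_real t) x) = - flip (integral {-\<rho>..\<rho>} h)" for \<rho>
    proof -
      have cont: "continuous_on X (\<lambda>t. h (- t))" for X unfolding h_def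
        by (intro bounded_linear.continuous_on[OF bounded_linear_scaleC_right]
            continuous_on_compose2[OF spectral_subspaces_continuous[OF spec, of UNIV]])
           (auto intro!: continuous_intros)
      have "integral {-\<rho>..\<rho>} (\<lambda>t. - flip (h (- t))) = - integral {-\<rho>..\<rho>} (\<lambda>t. flip (h (- t)))"
        by simp
      also have "integral {-\<rho>..\<rho>} (\<lambda>t. flip (h (- t))) = flip (integral {-\<rho>..\<rho>} (\<lambda>t. h (- t)))"
        using integral_linear[OF integrable_continuous_interval[OF cont] bounded_linear_flip]
        by (simp add: o_def)
      also have "integral {-\<rho>..\<rho>} (\<lambda>t. h (- t)) = integral {-\<rho>..\<rho>} h"
        using Henstock_Kurzweil_Integration.integral_reflect_real[of \<rho> "- \<rho>" h] by simp
      finally show ?thesis by (simp add: integrand)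
    qed
    moreover have "((\<lambda>\<rho>. - flip ((1 / (of_real pi * \<i>)) *\<^sub>C integral {-\<rho>..\<rho>} h))
        \<longlongrightarrow> - flip (proj_along Vp Vm (flip x) - proj_along Vm Vp (flip x))) at_top"
      using spec unfolding spectral_subspaces_def h_def
      by (intro tendsto_minus bounded_linear.tendsto[OF bounded_linear_flip]) blast
    ultimately show ?thesis by (simp add: flip_linear)
  qed
  thus ?thesis using dich' by (simp add: spectral_subspaces_def proj)
qed

lemma adj_uminus:
  assumes A: "densely_defined A"
  shows "dom_op (adj (uminus_op A)) = dom_op (adj A)"
    and "y \<in> dom_op (adj A) \<Longrightarrow> adj (uminus_op A) \<cdot> y = - (adj A \<cdot> y)"
    and "densely_defined (uminus_op A)"
proof -
  note linA = linear_op_rules[of A]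
  have lin: "linear_op A" using A by (simp add: densely_defined_def)
  show A': "densely_defined (uminus_op A)"
    using A linA[OF lin] by (auto simp: densely_defined_def linear_op_def uminus_op_def)
  have val: "y \<in> dom_op (adj (uminus_op A)) \<and> adj (uminus_op A) \<cdot> y = - (adj A \<cdot> y)"
    if "y \<in> dom_op (adj A)" for y
    using adjI[OF A', of y "- (adj A \<cdot> y)"] adjD[OF A that] by (auto simp: uminus_op_def)
  moreover have "y \<in> dom_op (adj A)" if "y \<in> dom_op (adj (uminus_op A))" for y
  proof (rule adjI(1)[OF A])
    fix x assume "x \<in> dom_op A"
    hence "- cinner (A \<cdot> x) y = cinner x (adj (uminus_op A) \<cdot> y)"
      using adjD[OF A' that, of x] by (simp add: uminus_op_def)
    hence "cinner (A \<cdot> x) y = - cinner x (adj (uminus_op A) \<cdot> y)" by (metis minus_minus)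
    thus "cinner (A \<cdot> x) y = cinner x (- (adj (uminus_op A) \<cdot> y))" by simp
  qed
  ultimately show "dom_op (adj (uminus_op A)) = dom_op (adj A)" by blast
  show "y \<in> dom_op (adj A) \<Longrightarrow> adj (uminus_op A) \<cdot> y = - (adj A \<cdot> y)" using val by blast
qed

lemma uminus_op_simps [simp]:
  "dom_op (uminus_op S) = dom_op S" "uminus_op S \<cdot> x = - (S \<cdot> x)" "uminus_op (uminus_op R) = R"
  for R :: "('a, 'b::group_add) operator"
  by (cases R; simp add: uminus_op_def)+

lemma spectral_subspaces_ham_uminus:
  assumes A: "densely_defined A" and B: "linear_op B" and dom: "dom_op (adj A) \<subseteq> dom_op B"
    and spec: "spectral_subspaces (ham A B C) Vp Vm"
  shows "spectral_subspaces (ham (uminus_op A) B C) (flip ` Vm) (flip ` Vp)"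
proof (rule spectral_subspaces_flip[OF _ _ spec])
  note adj = linear_op_rules[OF linear_op_adj[OF A]] and Blin = linear_op_rules[OF B]
  have neg: "- y \<in> dom_op (adj A) \<longleftrightarrow> y \<in> dom_op (adj A)" "- y \<in> dom_op B \<longleftrightarrow> y \<in> dom_op B" for y
    using csubspace_ops(5)[OF adj(1)] csubspace_ops(5)[OF Blin(1)] by (metis minus_minus)+
  show "dom_op (ham (uminus_op A) B C) = flip ` dom_op (ham A B C)"
    unfolding flip_image_vimage by (auto simp: ham_def adj_uminus[OF A] flip_def neg)
  show "ham (uminus_op A) B C \<cdot> flip w = - flip (ham A B C \<cdot> w)" if "w \<in> dom_op (ham A B C)" for w
    using that by (auto simp: ham_def flip_def adj_uminus(2)[OF A] neg adj(4) Blin(4))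
qed

lemma riccati_solution_uminus:
  assumes A: "densely_defined A" and B: "linear_op B" and dom: "dom_op (adj A) \<subseteq> dom_op B"
    and X: "bounded_clinear X" and ric: "riccati_solution A B C X"
  shows "riccati_solution (uminus_op A) B C (\<lambda>x. - X x)"
proof -
  note adj = linear_op_rules[OF linear_op_adj[OF A]] and Blin = linear_op_rules[OF B]
    and Xlin = bounded_clinear_rules[OF X]
  have "- X u \<in> dom_op (adj A)
      \<and> adj (uminus_op A) \<cdot> (- X u) + - X (- (A \<cdot> u)) + - X (B \<cdot> (- X u)) - C \<cdot> u = 0"
    if "u \<in> dom_op A" for u
  proof -
    have Xu: "X u \<in> dom_op (adj A)" and eq: "adj A \<cdot> X u + X (A \<cdot> u) + X (B \<cdot> X u) - C \<cdot> u = 0"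
      using ric that by (auto simp: riccati_solution_def)
    have neg: "- X u \<in> dom_op (adj A)" using csubspace_ops(5)[OF adj(1) Xu] .
    have "adj (uminus_op A) \<cdot> (- X u) = adj A \<cdot> X u"
      using adj_uminus(2)[OF A neg] adj(4)[OF Xu] by simp
    moreover have "B \<cdot> (- X u) = - (B \<cdot> X u)" using Blin(4)[of "X u"] Xu dom by blast
    ultimately show ?thesis using neg eq by (simp add: Xlin(5))
  qed
  thus ?thesis by (auto simp: riccati_solution_def adj_uminus(1)[OF A])
qed

lemma bounded_clinear_uminus: "bounded_clinear X \<Longrightarrow> bounded_clinear (\<lambda>x. - X x)"
  by (simp add: bounded_clinear_def bounded_linear_minus)

section \<open>The two sectorial cases\<close>

lemma sectorial_stabilizing_solution:
  fixes A B C :: "('a::complex_hilbert, 'a) operator"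
  assumes A: "sectorial A \<theta>" "\<theta> < pi / 2" "0 \<in> resolvent_set A"
    and B: "symmetric_op B" "nonneg_op B" and C: "symmetric_op C" "nonneg_op C"
    and dominant: "diagonally_dominant p A B C" and p: "p < 1"
    and spec: "spectral_subspaces (ham A B C) Vp Vm"
    and Xp: "symmetric_op Xp" "nonneg_op Xp" "graph Xp = Vp"
  shows "dom_op Xp = UNIV \<and> bounded_clinear (app Xp) \<and> riccati_solution A B C (app Xp) \<and>
    (\<forall>X. bounded_clinear X \<and> nonneg_op (Op UNIV X) \<and> riccati_solution A B C X \<longrightarrow> X = app Xp)"
proof -
  obtain K where K: "K > 0" "resolvent_decay A K" using sectorial_resolvent_decay[OF A] by blast
  have sub: "subordinate p C A" "subordinate p B (adj A)"
    using dominant by (auto simp: diagonally_dominant_def)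
  obtain cC where cC: "cC \<ge> 0" "dom_op A \<subseteq> dom_op C" "\<And>s x. s > 0 \<Longrightarrow> x \<in> dom_op A \<Longrightarrow>
      norm (C \<cdot> x) \<le> cC * s powr (p - 1) * (s * norm x + norm (A \<cdot> x))"
    using subordinate_additive[OF sub(1) p] by blast
  obtain cB where cB: "cB \<ge> 0" "dom_op (adj A) \<subseteq> dom_op B" "\<And>s y. s > 0 \<Longrightarrow> y \<in> dom_op (adj A) \<Longrightarrow>
      norm (B \<cdot> y) \<le> cB * s powr (p - 1) * (s * norm y + norm (adj A \<cdot> y))"
    using subordinate_additive[OF sub(2) p] by blast
  interpret sectorial_hamiltonian A B C p K cB cC
    using A(1) B C K p cC cB by unfold_locales (auto simp: sectorial_def)
  show ?thesis by (rule stabilizing_solution[OF spec Xp])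
qed

theorem theorem6p4:
  fixes A B C :: "('a::complex_hilbert, 'a) operator" and p :: real
  assumes "hamiltonian A B C" and "nonneg_op B" and "nonneg_op C"
    and "diagonally_dominant p A B C" and "p < 1"
    and "range (\<lambda>t::real. \<i> * of_real t) \<subseteq> resolvent_set A"
    and "(\<Inter>t::real. {x. resolvent (adj A) (- (\<i> * of_real t)) x \<in> dom_op B \<and>
                       B \<cdot> resolvent (adj A) (- (\<i> * of_real t)) x = 0}) = {0}"
  shows
    "(\<forall>\<theta> Vp Vm Xp.
        sectorial A \<theta> \<and> \<theta> < pi / 2 \<and>
        spectral_subspaces (ham A B C) Vp Vm \<and>
        selfadjoint Xp \<and> nonneg_op Xp \<and> graph Xp = Vp \<longrightarrow>
          dom_op Xp = UNIV \<and> bounded_clinear (app Xp) \<and> riccati_solution A B C (app Xp) \<and>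
          (\<forall>X. bounded_clinear X \<and> nonneg_op (Op UNIV X) \<and> riccati_solution A B C X
             \<longrightarrow> X = app Xp))
     \<and>
     (\<forall>\<theta> Vp Vm Xm.
        sectorial (uminus_op A) \<theta> \<and> \<theta> < pi / 2 \<and>
        spectral_subspaces (ham A B C) Vp Vm \<and>
        selfadjoint Xm \<and> nonpos_op Xm \<and> graph Xm = Vm \<longrightarrow>
          dom_op Xm = UNIV \<and> bounded_clinear (app Xm) \<and> riccati_solution A B C (app Xm) \<and>
          (\<forall>X. bounded_clinear X \<and> nonpos_op (Op UNIV X) \<and> riccati_solution A B C X
             \<longrightarrow> X = app Xm))"
proof (intro conjI[of "\<forall>\<theta> Vp Vm Xp. P \<theta> Vp Vm Xp" for P] allI impI; elim conjE)
  have A: "densely_defined A" and B: "symmetric_op B" and C: "symmetric_op C"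
    using assms(1) by (auto simp: hamiltonian_def)
  have "\<i> * of_real 0 \<in> resolvent_set A" using assms(6) by blast
  hence zero: "0 \<in> resolvent_set A" by simp
  note hyps = B assms(2) C assms(3)
  {
    fix \<theta> Vp Vm Xp
    assume "sectorial A \<theta>" "\<theta> < pi / 2" "spectral_subspaces (ham A B C) Vp Vm"
      "selfadjoint Xp" "nonneg_op Xp" "graph Xp = Vp"
    thus "dom_op Xp = UNIV \<and> bounded_clinear (app Xp) \<and> riccati_solution A B C (app Xp) \<and>
        (\<forall>X. bounded_clinear X \<and> nonneg_op (Op UNIV X) \<and> riccati_solution A B C X \<longrightarrow> X = app Xp)"
      using sectorial_stabilizing_solution[OF _ _ zero hyps assms(4,5)] selfadjoint_imp_symmetric
      by blast
  next
    fix \<theta> Vp Vm Xm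
    assume sect: "sectorial (uminus_op A) \<theta>" "\<theta> < pi / 2"
      and spec: "spectral_subspaces (ham A B C) Vp Vm"
      and Xm: "selfadjoint Xm" "nonpos_op Xm" "graph Xm = Vm"
    note adjA = adj_uminus[OF A]
    have linB: "linear_op B" using B by (rule symmetric_op_linear)
    have domB: "dom_op (adj A) \<subseteq> dom_op B"
      using assms(4) by (auto simp: diagonally_dominant_def subordinate_def)
    have nonneg_neg: "nonneg_op (uminus_op S)" if "nonpos_op S" for S :: "('a, 'a) operator"
      using that by (auto simp: nonneg_op_def nonpos_op_def complex_nonneg_Reals_iff complex_nonpos_Reals_iff)
    have zero': "0 \<in> resolvent_set (uminus_op A)"
    proof -
      obtain M where M: "M > 0" "\<And>x. norm (resolvent A 0 x) \<le> M * norm x"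
        using resolvent_bounded[OF zero] by blast
      note r = resolvent_props[OF zero]
      show ?thesis
      proof (rule resolvent_setI)
        show "linear_op (uminus_op A)" using adjA(3) by (simp add: densely_defined_def)
        show "\<exists>x\<in>dom_op (uminus_op A). uminus_op A \<cdot> x - 0 *\<^sub>C x = y" for y
          using r(1)[of "- y"] r(2)[of "- y"] by (intro bexI[of _ "resolvent A 0 (- y)"]) auto
        show "norm x \<le> M * norm (uminus_op A \<cdot> x - 0 *\<^sub>C x)" if "x \<in> dom_op (uminus_op A)" for x
          using M(2)[of "A \<cdot> x"] r(3)[of x "A \<cdot> x"] that by simp
      qed
    qed
    have dominant': "diagonally_dominant p (uminus_op A) B C"
      using assms(4) by (simp add: diagonally_dominant_def subordinate_def adjA)
    have sym: "symmetric_op Xm" using Xm(1) by (rule selfadjoint_imp_symmetric)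
    have sym': "symmetric_op (uminus_op Xm)"
      using sym adj_uminus(3)[of Xm] by (auto simp: symmetric_op_def)
    have graph': "graph (uminus_op Xm) = flip ` Vm"
      using Xm(3) by (force simp: graph_def flip_def image_image)
    have sol: "dom_op Xm = UNIV" "bounded_clinear (app (uminus_op Xm))"
      "riccati_solution (uminus_op A) B C (app (uminus_op Xm))"
      and uniq: "\<And>X. bounded_clinear X \<Longrightarrow> nonneg_op (Op UNIV X) \<Longrightarrow>
        riccati_solution (uminus_op A) B C X \<Longrightarrow> X = app (uminus_op Xm)"
      using sectorial_stabilizing_solution[OF sect zero' hyps dominant' assms(5)
          spectral_subspaces_ham_uminus[OF A linB domB spec] sym' nonneg_neg[OF Xm(2)] graph']
      by auto
    have "bounded_clinear (app Xm)" using bounded_clinear_uminus[OF sol(2)] by simp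
    moreover have "riccati_solution A B C (app Xm)"
      using riccati_solution_uminus[OF adjA(3) linB _ sol(2,3)] domB by (simp add: adjA(1))
    moreover have "X = app Xm"
      if X: "bounded_clinear X" "nonpos_op (Op UNIV X)" "riccati_solution A B C X" for X
    proof -
      have "nonneg_op (Op UNIV (\<lambda>x. - X x))" using nonneg_neg[OF X(2)] by (simp add: uminus_op_def)
      hence "(\<lambda>x. - X x) = app (uminus_op Xm)"
        using uniq[OF bounded_clinear_uminus[OF X(1)] _ riccati_solution_uminus[OF A linB domB X(1,3)]]
        by blast
      hence "- X x = - (Xm \<cdot> x)" for x by (metis uminus_op_simps(2))
      thus ?thesis by auto
    qed
    ultimately show "dom_op Xm = UNIV \<and> bounded_clinear (app Xm) \<and> riccati_solution A B C (app Xm) \<and>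
        (\<forall>X. bounded_clinear X \<and> nonpos_op (Op UNIV X) \<and> riccati_solution A B C X \<longrightarrow> X = app Xm)"
      using sol(1) by blast
  }
qed

end
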